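(* Let $(\mathcal{A},m)$ be a free multiarrangement in $V=\mathbb{K}^\ell$ with $\exp(\mathcal{A},m)=(d_1,\dots,d_\ell)$. Suppose $H_0\in\mathcal{A}$ is a heavy hyperplane with $m_0=m(H_0)$. Then: (1) $(\mathcal{A},m)$ has a good summand to $H_0$, and $m_0\in\exp(\mathcal{A},m)$. Write $\exp(\mathcal{A},m)=(m_0,d_2,\dots,d_\ell)$. (2) The Euler–Ziegler restriction $(\mathcal{A}^{H_0},m^{H_0})$ is free with $\exp(\mathcal{A}^{H_0},m^{H_0})=(d_2,\dots,d_\ell)$.
   Context: Let $\mathbb{K}$ be a field, $S=\mathbb{K}[x_1,\dots,x_\ell]$ and $V=\mathbb{K}^\ell$. A multiarrangement $(\mathcal{A},m)$ is a finite set of linear hyperplanes $H=\ker\alpha_H$ with multiplicity $m:\mathcal{A}\to\mathbb{Z}_{>0}$, and $|m|=\sum_Hm(H)$. $D(\mathcal{A},m)=\{\theta\in\mathrm{Der}_{\mathbb{K}}(S):\theta(\alpha_H)\in\alpha_H^{m(H)}S\ \forall H\}$. The multiarrangement is free if this is a free $S$-module; the exponents are the polynomial degrees of a homogeneous basis ($\theta$ has polynomial degree $d$ if all $\theta(x_i)$ are $0$ or homogeneous of degree $d$). The same notions apply in $H_0$, with coordinate ring $S/\alpha_{H_0}S$. $H_0$ is heavy if $2m(H_0)\ge|m|$. The Euler–Ziegler restriction is $\mathcal{A}^{H_0}=\{H_0\cap H:H\in\mathcal{A}\setminus\{H_0\}\}$ with $m^{H_0}(X)=\sum_{H\in\mathcal{A}_X\setminus\{H_0\}}m(H)$,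 where $\mathcal{A}_X=\{H:X\subseteq H\}$. A good summand to $H_0$ is a homogeneous $\theta_0\in D(\mathcal{A},m)$ of polynomial degree $m(H_0)$ with $\theta_0(\alpha_{H_0})=\alpha_{H_0}^{m(H_0)}$. *)

theory Defs
  imports "HOL-Library.Poly_Mapping" "HOL-Library.Multiset"
begin

text \<open>Polynomial ring S = K[x_i : i :: 'n], with 'n a finite type (ell = CARD('n)).
  A polynomial is a finitely supported map from monomials (exponent vectors) to coefficients.\<close>
type_synonym ('n, 'k) spoly = "('n \<Rightarrow>\<^sub>0 nat) \<Rightarrow>\<^sub>0 'k"

definition lf :: "('n::finite \<Rightarrow> 'k::field) \<Rightarrow> ('n \<Rightarrow> 'k) \<Rightarrow> 'k" where
  "lf a v = (\<Sum>i\<in>UNIV. a i * v i)"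

definition const_poly :: "'k::field \<Rightarrow> ('n::finite, 'k) spoly" where
  "const_poly c = Poly_Mapping.single 0 c"

definition var :: "'n::finite \<Rightarrow> ('n, 'k::field) spoly" where
  "var i = Poly_Mapping.single (Poly_Mapping.single i 1) 1"

definition lin_poly :: "('n::finite \<Rightarrow> 'k::field) \<Rightarrow> ('n, 'k) spoly" where
  "lin_poly a = (\<Sum>i\<in>UNIV. const_poly (a i) * var i)"

definition mdeg :: "('n::finite \<Rightarrow>\<^sub>0 nat) \<Rightarrow> nat" where
  "mdeg \<mu> = (\<Sum>i\<in>UNIV. Poly_Mapping.lookup \<mu> i)"

definition hom_or_zero :: "('n::finite, 'k::field) spoly \<Rightarrow> nat \<Rightarrow> bool" where
  "hom_or_zero f d \<longleftrightarrow> (\<forall>\<mu>\<in>Poly_Mapping.keys f. mdeg \<mu> = d)"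

text \<open>A K-derivation theta of S is represented by the tuple (theta(x_i))_i
  (Der_K(S) is free on the partial derivatives).  theta applied to a linear form:\<close>
definition dapp :: "('n::finite \<Rightarrow> ('n, 'k::field) spoly) \<Rightarrow> ('n \<Rightarrow> 'k) \<Rightarrow> ('n, 'k) spoly" where
  "dapp \<theta> a = (\<Sum>i\<in>UNIV. const_poly (a i) * \<theta> i)"

text \<open>Ambient space and coordinate ring.  The ambient space is the subspace
  W_L = {v. lf a v = 0 for a in L} of V, for a finite set L of linear forms;
  its coordinate ring is S/I_L with I_L the ideal generated by the lin_poly a, a in L.
  L = {} gives V with coordinate ring S; L = {alpha_H0} gives H0 with S / alpha_H0 S.
  Elements of S/I_L are represented by polynomials, compared modulo I_L.\<close>
definition Wsp :: "('n::finite \<Rightarrow> 'k::field) set \<Rightarrow> ('n \<Rightarrow> 'k) set" where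
  "Wsp L = {v. \<forall>a\<in>L. lf a v = 0}"

definition in_I :: "('n::finite \<Rightarrow> 'k::field) set \<Rightarrow> ('n, 'k) spoly \<Rightarrow> bool" where
  "in_I L f \<longleftrightarrow> (\<exists>r. f = (\<Sum>a\<in>L. r a * lin_poly a))"

definition congI :: "('n::finite \<Rightarrow> 'k::field) set \<Rightarrow> ('n, 'k) spoly \<Rightarrow> ('n, 'k) spoly \<Rightarrow> bool" where
  "congI L f g \<longleftrightarrow> in_I L (f - g)"

definition dvdI :: "('n::finite \<Rightarrow> 'k::field) set \<Rightarrow> ('n, 'k) spoly \<Rightarrow> ('n, 'k) spoly \<Rightarrow> bool" where
  "dvdI L p f \<longleftrightarrow> (\<exists>q. congI L f (p * q))"

definition is_hyperplane :: "('n::finite \<Rightarrow> 'k::field) set \<Rightarrow> ('n \<Rightarrow> 'k) set \<Rightarrow> bool" where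
  "is_hyperplane L H \<longleftrightarrow> (\<exists>a. H = {v \<in> Wsp L. lf a v = 0} \<and> H \<noteq> Wsp L)"

definition dform :: "('n::finite \<Rightarrow> 'k::field) set \<Rightarrow> ('n \<Rightarrow> 'k) set \<Rightarrow> ('n \<Rightarrow> 'k)" where
  "dform L H = (SOME a. H = {v \<in> Wsp L. lf a v = 0} \<and> H \<noteq> Wsp L)"

definition multiarr :: "('n::finite \<Rightarrow> 'k::field) set \<Rightarrow> ('n \<Rightarrow> 'k) set set \<Rightarrow> (('n \<Rightarrow> 'k) set \<Rightarrow> nat) \<Rightarrow> bool" where
  "multiarr L A m \<longleftrightarrow> finite A \<and> (\<forall>H\<in>A. is_hyperplane L H \<and> m H > 0)"

text \<open>D(A,m), as a set of derivations of S/I_L (tuples modulo I_L):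
  theta(I_L) is in I_L (so theta is a derivation of S/I_L), and theta(alpha_H) in alpha_H^{m(H)} (S/I_L).\<close>
definition Dmod :: "('n::finite \<Rightarrow> 'k::field) set \<Rightarrow> ('n \<Rightarrow> 'k) set set \<Rightarrow> (('n \<Rightarrow> 'k) set \<Rightarrow> nat)
    \<Rightarrow> ('n \<Rightarrow> ('n, 'k) spoly) set" where
  "Dmod L A m = {\<theta>. (\<forall>a\<in>L. in_I L (dapp \<theta> a)) \<and>
      (\<forall>H\<in>A. dvdI L (lin_poly (dform L H) ^ m H) (dapp \<theta> (dform L H)))}"

definition has_pdeg :: "('n::finite \<Rightarrow> 'k::field) set \<Rightarrow> ('n \<Rightarrow> ('n, 'k) spoly) \<Rightarrow> nat \<Rightarrow> bool" where
  "has_pdeg L \<theta> d \<longleftrightarrow> (\<exists>\<theta>'. (\<forall>i. congI L (\<theta> i) (\<theta>' i)) \<and> (\<forall>i. hom_or_zero (\<theta>' i) d))"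

definition free_exp :: "('n::finite \<Rightarrow> 'k::field) set \<Rightarrow> ('n \<Rightarrow> 'k) set set \<Rightarrow> (('n \<Rightarrow> 'k) set \<Rightarrow> nat)
    \<Rightarrow> nat multiset \<Rightarrow> bool" where
  "free_exp L A m E \<longleftrightarrow> (\<exists>B ds. length B = length ds \<and> mset ds = E \<and>
     (\<forall>j<length B. B ! j \<in> Dmod L A m \<and> has_pdeg L (B ! j) (ds ! j)) \<and>
     (\<forall>\<theta>\<in>Dmod L A m. \<exists>r. \<forall>i. congI L (\<theta> i) (\<Sum>j<length B. r j * (B ! j) i)) \<and>
     (\<forall>r. (\<forall>i. congI L (\<Sum>j<length B. r j * (B ! j) i) 0) \<longrightarrow> (\<forall>j<length B. congI L (r j) 0)))"

definition heavy :: "('n::finite \<Rightarrow> 'k::field) set set \<Rightarrow> (('n \<Rightarrow> 'k) set \<Rightarrow> nat) \<Rightarrow> ('n \<Rightarrow> 'k) set \<Rightarrow> bool" where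
  "heavy A m H0 \<longleftrightarrow> 2 * m H0 \<ge> (\<Sum>H\<in>A. m H)"

definition good_summand :: "('n::finite \<Rightarrow> 'k::field) set set \<Rightarrow> (('n \<Rightarrow> 'k) set \<Rightarrow> nat)
    \<Rightarrow> ('n \<Rightarrow> 'k) set \<Rightarrow> ('n \<Rightarrow> ('n, 'k) spoly) \<Rightarrow> bool" where
  "good_summand A m H0 \<theta>0 \<longleftrightarrow> \<theta>0 \<in> Dmod {} A m \<and> has_pdeg {} \<theta>0 (m H0) \<and>
     dapp \<theta>0 (dform {} H0) = lin_poly (dform {} H0) ^ m H0"

definition restr :: "('n::finite \<Rightarrow> 'k::field) set set \<Rightarrow> ('n \<Rightarrow> 'k) set \<Rightarrow> ('n \<Rightarrow> 'k) set set" where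
  "restr A H0 = (\<lambda>H. H0 \<inter> H) ` (A - {H0})"

definition mrestr :: "('n::finite \<Rightarrow> 'k::field) set set \<Rightarrow> (('n \<Rightarrow> 'k) set \<Rightarrow> nat) \<Rightarrow> ('n \<Rightarrow> 'k) set
    \<Rightarrow> ('n \<Rightarrow> 'k) set \<Rightarrow> nat" where
  "mrestr A m H0 X = (\<Sum>H\<in>{H\<in>A - {H0}. X \<subseteq> H}. m H)"

end

theory Submission
  imports Defs "Jordan_Normal_Form.Determinant"
begin

text \<open>The determinant of the matrix of a basis of D(A,m) divides the product Q of the alpha_H^m(H), as is seen
  locally at each H by comparing with derivations adapted to H; hence the exponents sum to at most
  |m|.  Write theta_j(alpha_0) = alpha_0^m_0 f_j for a homogeneous basis.  If two of the f_j are
  nonzero, heaviness and the degree bound force both degrees to be m_0, so these f_j are constants.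
  If only f_1 is nonzero, expanding the determinant along the alpha_0-row shows that f_1 times the
  complementary minor divides Q / alpha_0^m_0, while the latter divides that minor; so f_1 is
  again a constant.  Subtracting multiples of the good summand, the other basis elements kill
  alpha_0, and their reductions modulo alpha_0 have a determinant dividing the product of the forms
  of the restriction, so Cramer's rule shows that they form a basis there.\<close>

section \<open>Polynomial rings\<close>

text \<open>The local statement at H reads: the determinant divides \<open>p H ^ m H * Z\<close> for
  some Z prime to \<open>p H\<close>. To glue these, one starts from a crude global bound: Q times
  each partial derivative lies in D(A,m), so the determinant divides a power of Q. Primality of the
  linear forms then lowers the exponents to m(H), one hyperplane at a time. On the restriction,
  multiplicities add because the hyperplanes through X are distinct primes in S, so that their
  powers can be multiplied before reducing; modulo alpha_0 they all become multiples of a single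
  form. Cramer's rule accounts for spanning. For independence, a relation modulo alpha_0 says that a
  combination of the remaining basis elements equals alpha_0 times some eta. This eta lies in D(A,m)
  again, since alpha_0 is prime to the other forms, and comparing coefficients in the original basis
  shows that alpha_0 divides those of the relation.\<close>

lemma const_poly_simps [simp]:
  "const_poly 0 = (0 :: ('n::finite, 'k::field) spoly)"
  "const_poly 1 = (1 :: ('n::finite, 'k::field) spoly)"
  by (simp_all add: const_poly_def)

lemma const_poly_add: "const_poly (a + b) = const_poly a + const_poly b"
  by (simp add: const_poly_def single_add)

lemma const_poly_diff: "const_poly (a - b) = const_poly a - const_poly b"
  by (simp add: const_poly_def single_diff)

lemma const_poly_uminus: "const_poly (- a) = - const_poly a"
  by (simp add: const_poly_def single_uminus)

lemma const_poly_mult: "const_poly (a * b) = const_poly a * const_poly b"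
  by (simp add: const_poly_def mult_single)

lemma const_poly_inverse:
  assumes "a \<noteq> 0"
  shows "const_poly a * const_poly (inverse a) = 1" "const_poly (inverse a) * const_poly a = 1"
  using assms by (simp_all flip: const_poly_mult)

lemma const_poly_dvd_1: "a \<noteq> 0 \<Longrightarrow> const_poly a dvd 1"
  using const_poly_inverse(1) by (metis dvdI)

lemma spoly_sum_single: "f = (\<Sum>\<mu>\<in>Poly_Mapping.keys f. Poly_Mapping.single \<mu> (Poly_Mapping.lookup f \<mu>))"
  by (rule poly_mapping_eqI) (simp add: lookup_sum lookup_single when_def in_keys_iff)

lemma mult_eq_sum_single:
  "f * g = (\<Sum>\<mu>\<in>Poly_Mapping.keys f. \<Sum>\<nu>\<in>Poly_Mapping.keys g.
     Poly_Mapping.single (\<mu> + \<nu>) (Poly_Mapping.lookup f \<mu> * Poly_Mapping.lookup g \<nu>))"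
proof -
  have "f * g = (\<Sum>\<mu>\<in>Poly_Mapping.keys f. Poly_Mapping.single \<mu> (Poly_Mapping.lookup f \<mu>)) *
    (\<Sum>\<nu>\<in>Poly_Mapping.keys g. Poly_Mapping.single \<nu> (Poly_Mapping.lookup g \<nu>))"
    by (simp flip: spoly_sum_single)
  then show ?thesis
    by (simp add: sum_product mult_single)
qed

lemma exponent_sum_single:
  fixes \<mu> :: "'n::finite \<Rightarrow>\<^sub>0 nat"
  shows "(\<Sum>i\<in>UNIV. Poly_Mapping.single i (Poly_Mapping.lookup \<mu> i)) = \<mu>"
  by (rule poly_mapping_eqI) (simp add: lookup_sum lookup_single when_def)

lemma var_power: "var i ^ n = Poly_Mapping.single (Poly_Mapping.single i n) 1"
  by (induction n) (auto simp: var_def mult_single simp flip: single_add)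

lemma prod_single_one:
  "finite A \<Longrightarrow> (\<Prod>i\<in>A. Poly_Mapping.single (h i) (1::'k::field)) = Poly_Mapping.single (sum h A) 1"
  by (induction A rule: finite_induct) (auto simp: mult_single)

lemma single_eq_prod_var:
  "Poly_Mapping.single \<mu> c = const_poly c * (\<Prod>i\<in>UNIV. var i ^ Poly_Mapping.lookup \<mu> i)"
  by (simp add: var_power prod_single_one exponent_sum_single const_poly_def mult_single)

lemma spoly_induct [case_names const var add mult]:
  fixes f :: "('n::finite, 'k::field) spoly"
  assumes c: "\<And>c. P (const_poly c)" and v: "\<And>i. P (var i)"
    and a: "\<And>f g. P f \<Longrightarrow> P g \<Longrightarrow> P (f + g)" and m: "\<And>f g. P f \<Longrightarrow> P g \<Longrightarrow> P (f * g)"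
  shows "P f"
proof -
  have p: "P (f ^ n)" if "P f" for f n
    using that c[of 1] by (induction n) (auto intro: m)
  have q: "P (\<Prod>i\<in>A. h i)" if "finite A" "\<And>i. P (h i)" for A :: "'n set" and h
    using that c[of 1] by (induction A rule: finite_induct) (auto intro: m)
  have s: "P (\<Sum>i\<in>A. h i)" if "finite A" "\<And>i. P (h i)" for A :: "('n \<Rightarrow>\<^sub>0 nat) set" and h
    using that c[of 0] by (induction A rule: finite_induct) (auto intro: a)
  have "P (Poly_Mapping.single \<mu> d)" for \<mu> d
    unfolding single_eq_prod_var by (intro m c q p v) simp
  then show ?thesis
    by (subst spoly_sum_single) (intro s, auto)
qed

text \<open>The K-algebra endomorphism sending \<open>var i\<close> to \<open>s i\<close>. With
  linear forms as values it eliminates a variable; with constants it evaluates at a point.\<close>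

definition psubst :: "('n::finite \<Rightarrow> ('n, 'k::field) spoly) \<Rightarrow> ('n, 'k) spoly \<Rightarrow> ('n, 'k) spoly" where
  "psubst s f = (\<Sum>\<mu>\<in>Poly_Mapping.keys f.
     const_poly (Poly_Mapping.lookup f \<mu>) * (\<Prod>i\<in>UNIV. s i ^ Poly_Mapping.lookup \<mu> i))"

lemma psubst_superset:
  assumes "finite T" "Poly_Mapping.keys f \<subseteq> T"
  shows "psubst s f = (\<Sum>\<mu>\<in>T. const_poly (Poly_Mapping.lookup f \<mu>) * (\<Prod>i\<in>UNIV. s i ^ Poly_Mapping.lookup \<mu> i))"
  unfolding psubst_def using assms
  by (intro sum.mono_neutral_left) (auto simp: in_keys_iff)

lemma psubst_add: "psubst s (f + g) = psubst s f + psubst s g"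
  using keys_add[of f g]
  by (simp add: psubst_superset[of "Poly_Mapping.keys f \<union> Poly_Mapping.keys g"] lookup_add
      const_poly_add distrib_right sum.distrib)

lemma psubst_single: "psubst s (Poly_Mapping.single \<mu> c) = const_poly c * (\<Prod>i\<in>UNIV. s i ^ Poly_Mapping.lookup \<mu> i)"
  by (subst psubst_superset[of "{\<mu>}"]) auto

lemma psubst_zero [simp]: "psubst s 0 = 0"
  by (simp add: psubst_def)

lemma psubst_sum: "psubst s (sum f A) = (\<Sum>a\<in>A. psubst s (f a))"
  by (induction A rule: infinite_finite_induct) (auto simp: psubst_add)

lemma psubst_mult: "psubst s (f * g) = psubst s f * psubst s g"
proof -
  have "psubst s (f * g) = (\<Sum>\<mu>\<in>Poly_Mapping.keys f. \<Sum>\<nu>\<in>Poly_Mapping.keys g.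
      (const_poly (Poly_Mapping.lookup f \<mu>) * (\<Prod>i\<in>UNIV. s i ^ Poly_Mapping.lookup \<mu> i)) *
      (const_poly (Poly_Mapping.lookup g \<nu>) * (\<Prod>i\<in>UNIV. s i ^ Poly_Mapping.lookup \<nu> i)))"
    by (simp add: mult_eq_sum_single[of f g] psubst_sum psubst_single lookup_add power_add
        prod.distrib const_poly_mult mult_ac)
  also have "\<dots> = psubst s f * psubst s g"
    by (simp add: psubst_def sum_product)
  finally show ?thesis .
qed

lemma psubst_const [simp]: "psubst s (const_poly c) = const_poly c"
  by (simp add: const_poly_def psubst_single)

lemma psubst_var [simp]: "psubst s (var i) = s i"
proof -
  have "(\<Prod>j\<in>UNIV. s j ^ (1 when i = j)) = (\<Prod>j\<in>UNIV. if j = i then s j else 1)"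
    by (intro prod.cong) (auto simp: when_def)
  then have "psubst s (var i) = (\<Prod>j\<in>UNIV. if j = i then s j else 1)"
    by (simp add: var_def psubst_single lookup_single)
  then show ?thesis by simp
qed

lemma psubst_hom: "comm_ring_hom (psubst s)"
proof
  show "psubst s 1 = 1" using psubst_const[of s 1] by simp
qed (simp_all add: psubst_add psubst_mult)

lemma psubst_lin_poly: "psubst s (lin_poly a) = (\<Sum>i\<in>UNIV. const_poly (a i) * s i)"
  by (simp add: lin_poly_def psubst_sum psubst_mult)

lemma psubst_diff: "psubst s (f - g) = psubst s f - psubst s g"
proof -
  interpret comm_ring_hom "psubst s" by (rule psubst_hom)
  show ?thesis by (simp add: hom_minus)
qed

lemma psubst_dvd: "f dvd g \<Longrightarrow> psubst s f dvd psubst s g"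
  by (auto simp: dvd_def psubst_mult)

text \<open>The index type carries no order, so exponent vectors are transported along an injection
  into \<open>nat\<close>, where finitely supported functions are totally ordered compatibly with
  addition. The coefficient at the sum of the two leading exponents is the product of the leading
  coefficients.\<close>

lemma spoly_mult_nonzero:
  fixes f g :: "('n::finite, 'k::field) spoly"
  assumes "f \<noteq> 0" "g \<noteq> 0"
  shows "f * g \<noteq> 0"
proof -
  obtain enc :: "'n \<Rightarrow> nat" where enc: "inj enc"
    using finite_imp_inj_to_nat_seg[of "UNIV :: 'n set"] by auto
  define \<phi> :: "('n \<Rightarrow>\<^sub>0 nat) \<Rightarrow> (nat \<Rightarrow>\<^sub>0 nat)"
    where "\<phi> \<mu> = (\<Sum>i\<in>UNIV. Poly_Mapping.single (enc i) (Poly_Mapping.lookup \<mu> i))" for \<mu>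
  have add: "\<phi> (\<mu> + \<nu>) = \<phi> \<mu> + \<phi> \<nu>" for \<mu> \<nu>
    by (simp add: \<phi>_def lookup_add single_add sum.distrib)
  have "Poly_Mapping.lookup (\<phi> \<mu>) (enc j) = Poly_Mapping.lookup \<mu> j" for \<mu> j
    by (simp add: \<phi>_def lookup_sum lookup_single when_def inj_eq[OF enc])
  then have inj: "\<mu> = \<nu>" if "\<phi> \<mu> = \<phi> \<nu>" for \<mu> \<nu>
    using that by (metis poly_mapping_eqI)
  have max: "\<exists>\<mu>0\<in>Poly_Mapping.keys h. \<forall>\<mu>\<in>Poly_Mapping.keys h. \<phi> \<mu> \<le> \<phi> \<mu>0"
    if "h \<noteq> 0" for h :: "('n, 'k) spoly"
  proof -
    have "Max (\<phi> ` Poly_Mapping.keys h) \<in> \<phi> ` Poly_Mapping.keys h"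
      using that by (intro Max_in) auto
    then obtain \<mu>0 where "\<mu>0 \<in> Poly_Mapping.keys h" "Max (\<phi> ` Poly_Mapping.keys h) = \<phi> \<mu>0"
      by auto
    then show ?thesis by (metis Max_ge finite_imageI finite_keys image_eqI)
  qed
  obtain \<mu>0 where \<mu>0: "\<mu>0 \<in> Poly_Mapping.keys f" "\<And>\<mu>. \<mu> \<in> Poly_Mapping.keys f \<Longrightarrow> \<phi> \<mu> \<le> \<phi> \<mu>0"
    using max[OF assms(1)] by blast
  obtain \<nu>0 where \<nu>0: "\<nu>0 \<in> Poly_Mapping.keys g" "\<And>\<nu>. \<nu> \<in> Poly_Mapping.keys g \<Longrightarrow> \<phi> \<nu> \<le> \<phi> \<nu>0"
    using max[OF assms(2)] by blast
  have key: "\<mu> + \<nu> = \<mu>0 + \<nu>0 \<longleftrightarrow> (\<mu>, \<nu>) = (\<mu>0, \<nu>0)"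
    if "\<mu> \<in> Poly_Mapping.keys f" "\<nu> \<in> Poly_Mapping.keys g" for \<mu> \<nu>
  proof
    assume "\<mu> + \<nu> = \<mu>0 + \<nu>0"
    then have "\<phi> \<mu> + \<phi> \<nu> = \<phi> \<mu>0 + \<phi> \<nu>0" by (simp flip: add)
    then have "\<phi> \<mu> = \<phi> \<mu>0" "\<phi> \<nu> = \<phi> \<nu>0"
      using \<mu>0(2)[OF that(1)] \<nu>0(2)[OF that(2)]
      by (metis add_less_le_mono order_le_less order_less_irrefl,
          metis add_le_less_mono order_le_less order_less_irrefl)
    then show "(\<mu>, \<nu>) = (\<mu>0, \<nu>0)" by (auto intro: inj)
  qed auto
  have "Poly_Mapping.lookup (f * g) (\<mu>0 + \<nu>0) =
      (\<Sum>(\<mu>, \<nu>)\<in>Poly_Mapping.keys f \<times> Poly_Mapping.keys g.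
        (Poly_Mapping.lookup f \<mu> * Poly_Mapping.lookup g \<nu>) when \<mu> + \<nu> = \<mu>0 + \<nu>0)"
    by (simp add: mult_eq_sum_single[of f g] lookup_sum lookup_single flip: sum.cartesian_product)
  also have "\<dots> = (\<Sum>x\<in>Poly_Mapping.keys f \<times> Poly_Mapping.keys g.
        if x = (\<mu>0, \<nu>0) then Poly_Mapping.lookup f \<mu>0 * Poly_Mapping.lookup g \<nu>0 else 0)"
  proof (intro sum.cong refl)
    fix x assume "x \<in> Poly_Mapping.keys f \<times> Poly_Mapping.keys g"
    then show "(case x of (\<mu>, \<nu>) \<Rightarrow>
          (Poly_Mapping.lookup f \<mu> * Poly_Mapping.lookup g \<nu>) when \<mu> + \<nu> = \<mu>0 + \<nu>0) =
        (if x = (\<mu>0, \<nu>0) then Poly_Mapping.lookup f \<mu>0 * Poly_Mapping.lookup g \<nu>0 else 0)"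
      using key[of "fst x" "snd x"] by (cases "x = (\<mu>0, \<nu>0)") (auto simp: when_def)
  qed
  also have "\<dots> \<noteq> 0"
    using \<mu>0(1) \<nu>0(1) by (simp add: in_keys_iff)
  finally show ?thesis by auto
qed

lemma spoly_mult_cancel:
  fixes f g h :: "('n::finite, 'k::field) spoly"
  shows "f \<noteq> 0 \<Longrightarrow> f * g = f * h \<Longrightarrow> g = h"
  using spoly_mult_nonzero[of f "g - h"] by (auto simp: algebra_simps)

lemma spoly_power_nonzero: "f \<noteq> 0 \<Longrightarrow> f ^ n \<noteq> 0" for f :: "('n::finite, 'k::field) spoly"
  by (induction n) (simp_all add: spoly_mult_nonzero)

lemma spoly_prod_nonzero:
  "(\<And>i. i \<in> A \<Longrightarrow> h i \<noteq> 0) \<Longrightarrow> prod h A \<noteq> 0" for h :: "_ \<Rightarrow> ('n::finite, 'k::field) spoly"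
  by (induction A rule: infinite_finite_induct) (simp_all add: spoly_mult_nonzero)

lemma spoly_dvd_mult_cancel:
  fixes f g h :: "('n::finite, 'k::field) spoly"
  assumes "f \<noteq> 0" "f * g dvd f * h"
  shows "g dvd h"
proof -
  obtain q where "f * h = f * (g * q)" using assms(2) by (auto simp: dvd_def mult.assoc)
  then have "h = g * q" by (rule spoly_mult_cancel[OF assms(1)])
  then show ?thesis by simp
qed

section \<open>Homogeneous polynomials and linear forms\<close>

lemma hom_or_zeroD: "hom_or_zero f d \<Longrightarrow> \<mu> \<in> Poly_Mapping.keys f \<Longrightarrow> mdeg \<mu> = d"
  by (simp add: hom_or_zero_def)

lemma mdeg_add: "mdeg (\<mu> + \<nu>) = mdeg \<mu> + mdeg \<nu>"
  by (simp add: mdeg_def lookup_add sum.distrib)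

lemma hom_or_zero_zero [simp]: "hom_or_zero 0 d"
  by (simp add: hom_or_zero_def)

lemma hom_or_zero_add: "hom_or_zero f d \<Longrightarrow> hom_or_zero g d \<Longrightarrow> hom_or_zero (f + g) d"
  using keys_add[of f g] by (auto simp: hom_or_zero_def)

lemma hom_or_zero_uminus: "hom_or_zero f d \<Longrightarrow> hom_or_zero (- f) d"
  by (auto simp: hom_or_zero_def in_keys_iff)

lemma hom_or_zero_diff: "hom_or_zero f d \<Longrightarrow> hom_or_zero g d \<Longrightarrow> hom_or_zero (f - g) d"
  using hom_or_zero_add[of f d "- g"] by (simp add: hom_or_zero_uminus)

lemma hom_or_zero_mult: "hom_or_zero f d \<Longrightarrow> hom_or_zero g e \<Longrightarrow> hom_or_zero (f * g) (d + e)"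
  using keys_mult[of f g] by (fastforce simp: hom_or_zero_def mdeg_add)

lemma hom_or_zero_const [simp]: "hom_or_zero (const_poly c) 0"
  by (auto simp: hom_or_zero_def const_poly_def mdeg_def)

lemma hom_or_zero_one [simp]: "hom_or_zero 1 0"
  using hom_or_zero_const[of 1] by simp

lemma hom_or_zero_const_mult: "hom_or_zero f d \<Longrightarrow> hom_or_zero (const_poly c * f) d"
  using hom_or_zero_mult[OF hom_or_zero_const] by fastforce

lemma hom_or_zero_var: "hom_or_zero (var i) 1"
  by (auto simp: hom_or_zero_def var_def mdeg_def lookup_single when_def)

lemma hom_or_zero_sum: "(\<And>a. a \<in> A \<Longrightarrow> hom_or_zero (f a) d) \<Longrightarrow> hom_or_zero (sum f A) d"
  by (induction A rule: infinite_finite_induct) (auto intro: hom_or_zero_add)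

lemma hom_or_zero_prod:
  "(\<And>a. a \<in> A \<Longrightarrow> hom_or_zero (f a) (d a)) \<Longrightarrow> hom_or_zero (prod f A) (sum d A)"
  by (induction A rule: infinite_finite_induct) (auto intro: hom_or_zero_mult)

lemma hom_or_zero_power: "hom_or_zero f d \<Longrightarrow> hom_or_zero (f ^ n) (n * d)"
  by (induction n) (auto intro: hom_or_zero_mult)

lemma hom_or_zero_lin_poly: "hom_or_zero (lin_poly a) 1"
  unfolding lin_poly_def by (intro hom_or_zero_sum hom_or_zero_const_mult hom_or_zero_var)

lemma hom_or_zero_dapp: "(\<And>i. hom_or_zero (\<theta> i) d) \<Longrightarrow> hom_or_zero (dapp \<theta> a) d"
  unfolding dapp_def by (intro hom_or_zero_sum hom_or_zero_const_mult)

lemma hom_or_zero_dvd_le: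
  assumes "f dvd g" "hom_or_zero f d" "hom_or_zero g e" "g \<noteq> 0"
  shows "d \<le> e"
proof -
  obtain h where h: "g = f * h" using assms(1) by auto
  obtain \<mu> where \<mu>: "\<mu> \<in> Poly_Mapping.keys g" using assms(4) by fastforce
  then obtain \<alpha> \<beta> where "\<mu> = \<alpha> + \<beta>" "\<alpha> \<in> Poly_Mapping.keys f"
    using keys_mult[of f h] h by auto
  then show ?thesis
    using assms(2,3) \<mu> by (auto simp: hom_or_zero_def mdeg_add)
qed

lemma hom_or_zero_0_const:
  assumes "hom_or_zero f 0"
  shows "\<exists>c. f = const_poly c"
proof -
  have "\<mu> = 0" if "\<mu> \<in> Poly_Mapping.keys f" for \<mu>
    using hom_or_zeroD[OF assms that] by (intro poly_mapping_eqI) (simp add: mdeg_def)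
  then have "f = const_poly (Poly_Mapping.lookup f 0)"
    unfolding const_poly_def
    by (intro poly_mapping_eqI) (metis in_keys_iff lookup_single_eq lookup_single_not_eq)
  then show ?thesis by blast
qed

lemma hom_component:
  obtains f' where "hom_or_zero f' d" "\<And>\<mu>. \<mu> \<in> Poly_Mapping.keys (f - f') \<Longrightarrow> mdeg \<mu> \<noteq> d"
proof
  let ?T = "{\<mu> \<in> Poly_Mapping.keys f. mdeg \<mu> = d}"
  let ?f = "\<Sum>\<mu>\<in>?T. Poly_Mapping.single \<mu> (Poly_Mapping.lookup f \<mu>)"
  have l: "Poly_Mapping.lookup ?f \<mu> = (if \<mu> \<in> ?T then Poly_Mapping.lookup f \<mu> else 0)" for \<mu>
    by (simp add: lookup_sum lookup_single when_def)
  show "hom_or_zero ?f d"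
    unfolding hom_or_zero_def Ball_def in_keys_iff[of _ ?f] l by auto
  show "mdeg \<mu> \<noteq> d" if "\<mu> \<in> Poly_Mapping.keys (f - ?f)" for \<mu>
    using that unfolding in_keys_iff[of _ "f - ?f"] lookup_minus l
    by (auto simp: in_keys_iff split: if_splits)
qed

text \<open>Let \<open>f'\<close> be the degree d part of \<open>f\<close>. Then
  \<open>g * (f - f')\<close> is homogeneous of degree a + d, yet none of its monomials can have
  that degree, so it vanishes and \<open>f = f'\<close>.\<close>

lemma hom_or_zero_cofactor:
  assumes g: "hom_or_zero g a" "g \<noteq> 0" and gf: "hom_or_zero (g * f) (a + d)"
  shows "hom_or_zero f d"
proof -
  obtain f' where f': "hom_or_zero f' d" "\<And>\<mu>. \<mu> \<in> Poly_Mapping.keys (f - f') \<Longrightarrow> mdeg \<mu> \<noteq> d"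
    using hom_component by blast
  have h: "hom_or_zero (g * (f - f')) (a + d)"
    unfolding right_diff_distrib by (intro hom_or_zero_diff gf hom_or_zero_mult g(1) f'(1))
  have "\<mu> \<notin> Poly_Mapping.keys (g * (f - f'))" for \<mu>
  proof
    assume \<mu>: "\<mu> \<in> Poly_Mapping.keys (g * (f - f'))"
    then obtain \<alpha> \<beta> where "\<mu> = \<alpha> + \<beta>" "\<alpha> \<in> Poly_Mapping.keys g" "\<beta> \<in> Poly_Mapping.keys (f - f')"
      using keys_mult[of g "f - f'"] by auto
    then show False
      using h g(1) f'(2) \<mu> by (fastforce simp: hom_or_zero_def mdeg_add)
  qed
  then have "g * (f - f') = 0" by (metis equals0I keys_eq_empty)
  then have "f = f'" using spoly_mult_nonzero[of g "f - f'"] g(2) by auto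
  with f' show ?thesis by simp
qed

lemma lookup_lin_poly: "Poly_Mapping.lookup (lin_poly a) (Poly_Mapping.single i 1) = a i"
proof -
  have "Poly_Mapping.lookup (const_poly (a j) * var j) (Poly_Mapping.single i 1) = (if j = i then a j else 0)" for j
    using inj_single[of "1::nat"]
    by (auto simp: const_poly_def var_def mult_single lookup_single when_def inj_def
        dest: arg_cong[of _ _ "\<lambda>p. Poly_Mapping.lookup p j"])
  then show ?thesis by (simp add: lin_poly_def lookup_sum)
qed

lemma lin_poly_eq_0_iff: "lin_poly a = 0 \<longleftrightarrow> a = (\<lambda>_. 0)"
proof
  assume "lin_poly a = 0"
  then show "a = (\<lambda>_. 0)" by (metis lookup_lin_poly lookup_zero)
qed (simp add: lin_poly_def)

lemma lin_poly_lincomb: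
  "lin_poly (\<lambda>i. c * a i + d * b i) = const_poly c * lin_poly a + const_poly d * lin_poly b"
  by (simp add: lin_poly_def const_poly_add const_poly_mult sum.distrib distrib_right sum_distrib_left mult.assoc)

lemma dapp_lincomb:
  "dapp \<theta> (\<lambda>i. c * a i + d * b i) = const_poly c * dapp \<theta> a + const_poly d * dapp \<theta> b"
  by (simp add: dapp_def const_poly_add const_poly_mult sum.distrib distrib_right sum_distrib_left mult.assoc)

lemma lf_lincomb: "lf (\<lambda>i. c * a i + d * b i) v = c * lf a v + d * lf b v"
  by (simp add: lf_def sum.distrib distrib_right sum_distrib_left mult.assoc)

lemma lf_scale: "lf (\<lambda>i. c * a i) v = c * lf a v"
  by (simp add: lf_def sum_distrib_left mult.assoc)

text \<open>The vector with entry \<open>a k\<close> at i and \<open>- a i\<close> at k lies in the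
  kernel of \<open>a\<close>; that \<open>b\<close> kills it too determines
  \<open>b i\<close>.\<close>

lemma lf_kernel_subset:
  assumes "\<And>v. lf a v = 0 \<Longrightarrow> lf b v = 0" and "a k \<noteq> 0"
  shows "b = (\<lambda>i. (b k / a k) * a i)"
proof
  fix i
  have s: "lf c (\<lambda>j. if j = i then x else if j = k then y else 0) = c i * x + c k * y"
    if "i \<noteq> k" for c :: "'a \<Rightarrow> 'b" and x y
  proof -
    have "lf c (\<lambda>j. if j = i then x else if j = k then y else 0) =
      (\<Sum>j\<in>UNIV. (if j = i then c i * x else 0) + (if j = k then c k * y else 0))"
      unfolding lf_def using that by (intro sum.cong) auto
    then show ?thesis by (simp add: sum.distrib)
  qed
  show "b i = (b k / a k) * a i"
  proof (cases "i = k")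
    case False
    have "b i * a k + b k * (- a i) = 0"
      using assms(1)[of "\<lambda>j. if j = i then a k else if j = k then - a i else 0"] s[OF False] by simp
    then show ?thesis using assms(2) by (simp add: field_simps)
  qed (use assms(2) in auto)
qed

text \<open>\<open>sred a k\<close> eliminates the variable \<open>k\<close> by means of \<open>a = 0\<close>; it realises the quotient
  of the polynomial ring by \<open>lin_poly a\<close> inside the polynomial ring itself, so that congruence
  and divisibility modulo \<open>lin_poly a\<close> become equality and divisibility of images.\<close>

definition lred :: "('n::finite \<Rightarrow> 'k::field) \<Rightarrow> 'n \<Rightarrow> ('n \<Rightarrow> 'k) \<Rightarrow> ('n \<Rightarrow> 'k)" where
  "lred a k b = (\<lambda>i. b i - (b k / a k) * a i)"

definition sred :: "('n::finite \<Rightarrow> 'k::field) \<Rightarrow> 'n \<Rightarrow> ('n, 'k) spoly \<Rightarrow> ('n, 'k) spoly" where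
  "sred a k = psubst (\<lambda>i. if i = k then var k - const_poly (inverse (a k)) * lin_poly a else var i)"

lemma lred_k [simp]: "a k \<noteq> 0 \<Longrightarrow> lred a k b k = 0"
  by (simp add: lred_def)

lemma lin_poly_lred: "lin_poly (lred a k b) = lin_poly b - const_poly (b k / a k) * lin_poly a"
  using lin_poly_lincomb[of 1 b "- (b k / a k)" a] by (simp add: lred_def const_poly_uminus)

lemma dapp_lred: "dapp \<theta> (lred a k b) = dapp \<theta> b - const_poly (b k / a k) * dapp \<theta> a"
  using dapp_lincomb[of \<theta> 1 b "- (b k / a k)" a] by (simp add: lred_def const_poly_uminus)

lemma lf_lred: "lf (lred a k b) v = lf b v - (b k / a k) * lf a v"
  using lf_lincomb[of 1 b "- (b k / a k)" a v] by (simp add: lred_def)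

lemma sred_lin_poly: "sred a k (lin_poly b) = lin_poly (lred a k b)"
proof -
  have "sred a k (lin_poly b) = (\<Sum>i\<in>UNIV. const_poly (b i) * var i
     - (if i = k then const_poly (b k / a k) * lin_poly a else 0))"
    unfolding sred_def psubst_lin_poly
    by (intro sum.cong) (auto simp: right_diff_distrib divide_inverse const_poly_mult mult_ac)
  also have "\<dots> = lin_poly b - const_poly (b k / a k) * lin_poly a"
    by (simp add: sum_subtractf lin_poly_def[of b])
  finally show ?thesis by (simp add: lin_poly_lred)
qed

lemma sred_self [simp]: "a k \<noteq> 0 \<Longrightarrow> sred a k (lin_poly a) = 0"
  by (simp add: sred_lin_poly lred_def lin_poly_eq_0_iff)

lemma sred_hom: "comm_ring_hom (sred a k)"
  unfolding sred_def by (rule psubst_hom)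

lemma dvd_sred_diff: "lin_poly a dvd f - sred a k f"
proof (induction f rule: spoly_induct)
  case (mult f g)
  have "f * g - sred a k (f * g) = f * (g - sred a k g) + (f - sred a k f) * sred a k g"
    by (simp add: sred_def psubst_mult algebra_simps)
  then show ?case using mult by simp
next
  case (add f g)
  have "f + g - sred a k (f + g) = (f - sred a k f) + (g - sred a k g)"
    by (simp add: sred_def psubst_add)
  then show ?case using add by (metis dvd_add)
qed (simp_all add: sred_def)

text \<open>\<open>sred a k\<close> changes a polynomial only by multiples of
  \<open>lin_poly a\<close> and kills that form, so its kernel is the ideal generated by it.\<close>

lemma sred_eq_0_iff: "a k \<noteq> 0 \<Longrightarrow> sred a k f = 0 \<longleftrightarrow> lin_poly a dvd f"
proof
  assume "sred a k f = 0"
  then show "lin_poly a dvd f" using dvd_sred_diff[of a f k] by simp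
next
  assume "a k \<noteq> 0" "lin_poly a dvd f"
  then have "sred a k (lin_poly a) dvd sred a k f" unfolding sred_def by (intro psubst_dvd)
  then show "sred a k f = 0" using \<open>a k \<noteq> 0\<close> by simp
qed

lemma sred_idem [simp]: "a k \<noteq> 0 \<Longrightarrow> sred a k (sred a k f) = sred a k f"
  using dvd_sred_diff[of a f k] sred_eq_0_iff[of a k "f - sred a k f"]
  by (simp add: sred_def psubst_diff)

text \<open>The form generates the kernel of an endomorphism of an integral domain, and such a
  kernel is a prime ideal.\<close>

lemma prime_elem_lin_poly:
  assumes "a \<noteq> (\<lambda>_. 0)"
  shows "prime_elem (lin_poly a)"
proof -
  obtain k where k: "a k \<noteq> 0" using assms by auto
  have z: "sred a k f = 0 \<longleftrightarrow> lin_poly a dvd f" for f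
    by (rule sred_eq_0_iff) (rule k)
  have one: "sred a k 1 = 1" using psubst_const[of _ 1] by (simp add: sred_def)
  show ?thesis
  proof (rule prime_elemI)
    show "lin_poly a \<noteq> 0" using assms by (simp add: lin_poly_eq_0_iff)
    show "\<not> lin_poly a dvd 1" using z[of 1] one by simp
    show "lin_poly a dvd f \<or> lin_poly a dvd g" if "lin_poly a dvd f * g" for f g
      using that spoly_mult_nonzero[of "sred a k f" "sred a k g"] 
      by (auto simp flip: z simp: sred_def psubst_mult)
  qed
qed

text \<open>Evaluation at \<open>v\<close> turns the divisibility of forms into one of scalars: 0
  divides \<open>lf b v\<close>.\<close>

lemma lin_poly_dvd_kernel:
  assumes "lin_poly a dvd lin_poly b" "lf a v = 0"
  shows "lf b v = 0"
proof -
  have s: "psubst (\<lambda>i. const_poly (v i)) (lin_poly c) = const_poly (lf c v)" for c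
  proof -
    have "const_poly (sum h A) = (\<Sum>i\<in>A. const_poly (h i) :: ('a, 'b) spoly)" for h :: "'a \<Rightarrow> 'b" and A
      by (induction A rule: infinite_finite_induct) (auto simp: const_poly_add)
    then show ?thesis by (simp add: psubst_lin_poly lf_def const_poly_mult)
  qed
  have "const_poly (lf a v) dvd (const_poly (lf b v) :: ('a, 'b) spoly)"
    using psubst_dvd[OF assms(1), of "\<lambda>i. const_poly (v i)"] by (simp add: s)
  then have "const_poly (lf b v) = (0 :: ('a, 'b) spoly)" using assms(2) by simp
  then have "Poly_Mapping.lookup (const_poly (lf b v) :: ('a, 'b) spoly) 0 = 0" by simp
  then show ?thesis by (simp add: const_poly_def)
qed

section \<open>Divisibility by powers of prime elements\<close>

lemma prime_power_dvd_mult: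
  fixes p :: "('n::finite, 'k::field) spoly"
  assumes p: "prime_elem p" "\<not> p dvd f" and d: "p ^ m dvd f * g"
  shows "p ^ m dvd g"
  using d
proof (induction m arbitrary: g)
  case (Suc m)
  have "p dvd f * g" by (rule dvd_trans[OF _ Suc.prems]) simp
  then have "p dvd g" using prime_elem_dvd_multD[OF p(1)] p(2) by blast
  then obtain g' where g': "g = p * g'" by (rule dvdE)
  have "p * p ^ m dvd p * (f * g')" using Suc.prems g' by (simp add: mult_ac)
  then have "p ^ m dvd f * g'" by (rule spoly_dvd_mult_cancel[rotated]) (use p(1) in auto)
  then have "p ^ m dvd g'" by (rule Suc.IH)
  then show ?case unfolding g' by (simp add: mult_dvd_mono)
qed simp

lemma prime_not_dvd_prod:
  fixes p :: "'a::comm_semiring_1"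
  assumes "prime_elem p" "\<And>i. i \<in> A \<Longrightarrow> \<not> p dvd h i"
  shows "\<not> p dvd prod h A"
  using assms(2)
  by (induction A rule: infinite_finite_induct)
     (use assms(1) in \<open>auto simp: prime_elem_dvd_mult_iff prime_elem_not_unit\<close>)

text \<open>Once the earlier powers are split off, \<open>f = (product) * g\<close>, the next prime
  does not divide that product, so its power must divide \<open>g\<close>.\<close>

lemma prod_prime_powers_dvd:
  fixes p :: "'i \<Rightarrow> ('n::finite, 'k::field) spoly"
  assumes "finite A" "\<And>i. i \<in> A \<Longrightarrow> prime_elem (p i)"
    "\<And>i j. i \<in> A \<Longrightarrow> j \<in> A \<Longrightarrow> i \<noteq> j \<Longrightarrow> \<not> p i dvd p j"
    "\<And>i. i \<in> A \<Longrightarrow> p i ^ m i dvd f"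
  shows "(\<Prod>i\<in>A. p i ^ m i) dvd f"
  using assms
proof (induction A rule: finite_induct)
  case (insert i A)
  have "(\<Prod>i\<in>A. p i ^ m i) dvd f" using insert.prems by (intro insert.IH) simp_all
  then obtain g where g: "f = (\<Prod>i\<in>A. p i ^ m i) * g" by (rule dvdE)
  have "\<not> p i dvd (\<Prod>i\<in>A. p i ^ m i)"
    using insert.prems(1)[of i] insert.prems(2)[of i] insert.hyps(2)
    by (intro prime_not_dvd_prod) (simp, metis insertI1 insertI2 prime_elem_dvd_power)
  then have "p i ^ m i dvd g"
    using insert.prems(1)[of i] insert.prems(3)[of i] unfolding g
    by (metis insertI1 prime_power_dvd_mult)
  then have "(\<Prod>i\<in>A. p i ^ m i) * p i ^ m i dvd f" unfolding g by (rule mult_dvd_mono[OF dvd_refl])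
  then show ?case using insert.hyps by (simp add: mult.commute)
qed simp

text \<open>The divisibility involving Z bounds the order of \<open>g\<close> at p by m. If
  \<open>p ^ Suc k * Y = g * h\<close> with m below \<open>Suc k\<close>, then p divides
  \<open>h\<close>, as otherwise \<open>p ^ Suc k\<close> would divide \<open>g\<close>. One factor
  p can thus be cancelled, and this is repeated down to m.\<close>

lemma dvd_reduce_prime_power:
  fixes p :: "('n::finite, 'k::field) spoly"
  assumes p: "prime_elem p" "\<not> p dvd Z" and Z: "g dvd p ^ m * Z"
    and Y: "g dvd p ^ k * Y" and le: "m \<le> k"
  shows "g dvd p ^ m * Y"
  using Y le
proof (induction k)
  case (Suc k)
  show ?case
  proof (cases "m = Suc k")
    case False
    obtain h where h: "p ^ Suc k * Y = g * h" using Suc.prems by auto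
    have p0: "p \<noteq> 0" using p(1) by auto
    have "p dvd h"
    proof (rule ccontr)
      assume "\<not> p dvd h"
      then have "p ^ Suc k dvd g"
        using prime_power_dvd_mult[OF p(1), of h "Suc k" g] h by (metis dvd_triv_left mult.commute)
      then have "p ^ Suc m dvd p ^ m * Z"
        using Z False Suc.prems(2) by (meson dvd_trans le_imp_power_dvd le_neq_implies_less Suc_leI less_Suc_eq_le)
      then have "p ^ m * p dvd p ^ m * Z" by (simp add: mult.commute)
      then show False using spoly_dvd_mult_cancel spoly_power_nonzero[OF p0] p(2) by blast
    qed
    then obtain h' where "h = p * h'" by auto
    then have "p * (p ^ k * Y) = p * (g * h')" using h by (simp add: mult_ac)
    then have "p ^ k * Y = g * h'" by (rule spoly_mult_cancel[OF p0])
    then show ?thesis using Suc False by auto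
  qed (use Suc in auto)
qed auto

section \<open>Determinants and bases of derivation modules\<close>

lemma if_zero_mult: "(if P then x else 0) * y = (if P then x * y else 0)" for x :: "'a::semiring_0"
  by simp

lemma mat_mult_fun:
  "mat n n (\<lambda>(i, j). f i j) * mat n n (\<lambda>(i, j). g i j) = mat n n (\<lambda>(i, j). \<Sum>k<n. f i k * g k j)"
  by (rule eq_matI) (auto simp: scalar_prod_def atLeast0LessThan)

lemma det_diagonal: "det (mat n n (\<lambda>(i, j). if i = j then d i else 0)) = (\<Prod>i<n. d i)"
  by (subst det_upper_triangular[where n = n])
     (auto simp: upper_triangular_def prod_list_diag_prod atLeast0LessThan)

text \<open>Padding the left factor with zero columns from width b to width a makes both factors
  square and leaves the product unchanged. That product has determinant \<open>q ^ a\<close>, while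
  the padded factor has determinant 0.\<close>

lemma scalar_matrix_factor_narrow:
  fixes f g :: "nat \<Rightarrow> nat \<Rightarrow> 'a::comm_ring_1"
  assumes "\<And>i j. i < a \<Longrightarrow> j < a \<Longrightarrow> (\<Sum>k<b. f i k * g k j) = (if i = j then q else 0)" and "b < a"
  shows "q ^ a = 0"
proof -
  define f' where "f' i k = (if k < b then f i k else 0)" for i k
  let ?F = "mat a a (\<lambda>(i, j). f' i j)" and ?G = "mat a a (\<lambda>(i, j). g i j)"
  have "(\<Sum>k<a. f' i k * g k j) = (\<Sum>k<b. f i k * g k j)" for i j
    using assms(2) by (intro sum.mono_neutral_cong_right) (auto simp: f'_def)
  then have "?F * ?G = mat a a (\<lambda>(i, j). if i = j then q else 0)"
    unfolding mat_mult_fun by (intro eq_matI) (use assms(1) in auto)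
  then have "det ?F * det ?G = q ^ a"
    using det_mult[of ?F a ?G] by (simp add: det_diagonal)
  moreover have "det ?F = 0"
    using assms(2) by (subst laplace_expansion_column[of _ a b]) (auto simp: f'_def)
  ultimately show ?thesis by simp
qed

text \<open>Multiplying the row vector c M, whose entries are divisible by p, by the adjugate of M
  on the right gives det M times c. In the applications c holds the coefficients of a linear form
  and the columns of M are derivations.\<close>

lemma dvd_mult_det:
  fixes M :: "'a::comm_ring_1 mat"
  assumes M: "M \<in> carrier_mat n n"
    and dvd: "\<And>j. j < n \<Longrightarrow> p dvd (\<Sum>i<n. c i * M $$ (i, j))" and k: "k < n"
  shows "p dvd c k * det M"
proof -
  have entry: "(\<Sum>j<n. M $$ (i, j) * adj_mat M $$ (j, k)) = (if i = k then det M else 0)" if "i < n" for i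
  proof -
    have "(M * adj_mat M) $$ (i, k) = (det M \<cdot>\<^sub>m 1\<^sub>m n) $$ (i, k)"
      using adj_mat(2)[OF M] by simp
    then show ?thesis
      using M adj_mat(1)[OF M] that k by (simp add: scalar_prod_def atLeast0LessThan)
  qed
  have "c k * det M = (\<Sum>i<n. c i * (\<Sum>j<n. M $$ (i, j) * adj_mat M $$ (j, k)))"
    using k by (simp add: entry if_distrib cong: if_cong)
  also have "\<dots> = (\<Sum>j<n. (\<Sum>i<n. c i * M $$ (i, j)) * adj_mat M $$ (j, k))"
    by (simp add: sum_distrib_left sum_distrib_right mult.assoc) (rule sum.swap)
  also have "p dvd \<dots>" by (rule dvd_sum) (simp add: dvd_mult2 dvd)
  finally show ?thesis .
qed

lemma hom_or_zero_det:
  assumes M: "M \<in> carrier_mat n n" and h: "\<And>i j. i < n \<Longrightarrow> j < n \<Longrightarrow> hom_or_zero (M $$ (i, j)) (d j)"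
  shows "hom_or_zero (det M) (\<Sum>j<n. d j)"
  unfolding det_def'[OF M]
proof (rule hom_or_zero_sum)
  fix p assume "p \<in> {p. p permutes {0..<n}}"
  then have p: "p permutes {0..<n}" by simp
  have "hom_or_zero (\<Prod>i = 0..<n. M $$ (i, p i)) (\<Sum>i = 0..<n. d (p i))"
    using permutes_in_image[OF p] by (intro hom_or_zero_prod h) auto
  moreover have "(\<Sum>i = 0..<n. d (p i)) = (\<Sum>j<n. d j)"
    using sum.permute[OF p, of d] by (simp add: atLeast0LessThan comp_def)
  moreover have "signof p = (1 :: ('a, 'b) spoly) \<or> signof p = (-1 :: ('a, 'b) spoly)"
    by (cases p rule: sign_cases) auto
  ultimately show "hom_or_zero (signof p * (\<Prod>i = 0..<n. M $$ (i, p i))) (\<Sum>j<n. d j)"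
    by (auto intro: hom_or_zero_uminus)
qed

text \<open>The passage from local to global: the hypothesis on Z bounds the order of
  \<open>g\<close> at each \<open>p i\<close> by \<open>m i\<close>, so the excessive exponents
  \<open>m i * l\<close> can be lowered one index after another.\<close>

lemma dvd_prod_reduce_exponents:
  fixes p :: "'i \<Rightarrow> ('n::finite, 'k::field) spoly"
  assumes "finite A" "\<And>i. i \<in> A \<Longrightarrow> prime_elem (p i)"
    and g: "g dvd (\<Prod>i\<in>A. p i ^ (m i * l))" and l: "l > 0"
    and Z: "\<And>i. i \<in> A \<Longrightarrow> \<exists>Z. \<not> p i dvd Z \<and> g dvd p i ^ m i * Z"
  shows "g dvd (\<Prod>i\<in>A. p i ^ m i)"
proof -
  \<comment> \<open>Invariant of the induction: T collects the indices whose exponent has already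
    been lowered.\<close>
  have "g dvd (\<Prod>i\<in>T. p i ^ m i) * (\<Prod>i\<in>A - T. p i ^ (m i * l))" if "T \<subseteq> A" for T
    using finite_subset[OF that assms(1)] that
  proof (induction T rule: finite_induct)
    case (insert j T)
    let ?Y = "(\<Prod>i\<in>T. p i ^ m i) * (\<Prod>i\<in>A - insert j T. p i ^ (m i * l))"
    have AT: "A - T = insert j (A - insert j T)" using insert.prems insert.hyps(2) by auto
    have "(\<Prod>i\<in>T. p i ^ m i) * (\<Prod>i\<in>A - T. p i ^ (m i * l)) = p j ^ (m j * l) * ?Y"
      unfolding AT using assms(1) by (subst prod.insert) (auto simp: mult_ac)
    then have Y: "g dvd p j ^ (m j * l) * ?Y" using insert by simp
    have j: "j \<in> A" using insert.prems by simp
    obtain Z where "\<not> p j dvd Z" "g dvd p j ^ m j * Z" using Z[OF j] by blast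
    from dvd_reduce_prime_power[OF assms(2)[OF j] this Y] have "g dvd p j ^ m j * ?Y"
      using l by simp
    then show ?case using insert.hyps by (simp add: mult_ac)
  qed (use g in simp)
  from this[of A] show ?thesis by simp
qed

section \<open>Derivation modules over the full ring and their bases\<close>

lemma in_I_empty: "in_I {} f \<longleftrightarrow> f = 0"
  by (simp add: in_I_def)

lemma congI_empty [simp]: "congI {} f g \<longleftrightarrow> f = g"
  by (simp add: congI_def in_I_empty)

lemma dvdI_empty [simp]: "dvdI {} p f \<longleftrightarrow> p dvd f"
  by (simp add: dvdI_def dvd_def)

lemma has_pdeg_empty: "has_pdeg {} \<theta> d \<longleftrightarrow> (\<forall>i. hom_or_zero (\<theta> i) d)"
  by (auto simp: has_pdeg_def)

lemma Dmod_empty_iff: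
  "\<theta> \<in> Dmod {} A m \<longleftrightarrow> (\<forall>H\<in>A. lin_poly (dform {} H) ^ m H dvd dapp \<theta> (dform {} H))"
  by (simp add: Dmod_def)

lemma dapp_sum: "dapp (\<lambda>i. \<Sum>j\<in>J. r j * b j i) a = (\<Sum>j\<in>J. r j * dapp (b j) a)"
  unfolding dapp_def sum_distrib_left
  by (subst sum.swap) (simp add: mult_ac)

lemma dapp_diff: "dapp (\<lambda>i. \<theta> i - \<eta> i) a = dapp \<theta> a - dapp \<eta> a"
  by (simp add: dapp_def right_diff_distrib sum_subtractf)

lemma dapp_mult: "dapp (\<lambda>i. f * \<theta> i) a = f * dapp \<theta> a"
  by (simp add: dapp_def sum_distrib_left mult_ac)

lemma dapp_delta: "dapp (\<lambda>l. if l = i then f else 0) a = const_poly (a i) * f"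
  by (simp add: dapp_def if_distrib cong: if_cong)

lemma Dmod_empty_diff: "\<theta> \<in> Dmod {} A m \<Longrightarrow> \<eta> \<in> Dmod {} A m \<Longrightarrow> (\<lambda>i. \<theta> i - \<eta> i) \<in> Dmod {} A m"
  by (auto simp: Dmod_empty_iff dapp_diff)

lemma Dmod_empty_mult: "\<theta> \<in> Dmod {} A m \<Longrightarrow> (\<lambda>i. f * \<theta> i) \<in> Dmod {} A m"
  by (auto simp: Dmod_empty_iff dapp_mult)

text \<open>The basis clauses of \<open>free_exp\<close> over the full ring, without degrees. The
  family is a function on numbers, so that reordering is composition with a permutation.\<close>

definition poly_basis :: "('n::finite \<Rightarrow> ('n, 'k::field) spoly) set \<Rightarrow> nat \<Rightarrow> (nat \<Rightarrow> 'n \<Rightarrow> ('n, 'k) spoly) \<Rightarrow> bool" where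
  "poly_basis D n b \<longleftrightarrow> (\<forall>j<n. b j \<in> D) \<and> (\<forall>\<theta>\<in>D. \<exists>r. \<forall>i. \<theta> i = (\<Sum>j<n. r j * b j i)) \<and>
     (\<forall>r. (\<forall>i. (\<Sum>j<n. r j * b j i) = 0) \<longrightarrow> (\<forall>j<n. r j = 0))"

lemma poly_basis_indep:
  assumes "poly_basis D n b" "\<And>i. (\<Sum>j<n. r j * b j i) = 0" "j < n"
  shows "r j = 0"
  using assms unfolding poly_basis_def by blast

text \<open>Expanding the vectors q e_i of D in the basis yields coefficients r such that the
  matrices of \<open>b\<close> and \<open>r\<close> multiply to q times the identity, in both
  orders. Either inequality between n and the number of coordinates would then give such a
  factorisation through a smaller size, making a power of q vanish.\<close>

lemma poly_basis_card:
  fixes D :: "('n::finite \<Rightarrow> ('n, 'k::field) spoly) set"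
  assumes b: "poly_basis D n b" and q: "q \<noteq> 0" "\<And>i. (\<lambda>l. if l = i then q else 0) \<in> D"
  shows "n = card (UNIV :: 'n set)"
proof -
  obtain e :: "nat \<Rightarrow> 'n" where e: "bij_betw e {..<card (UNIV :: 'n set)} UNIV"
    using ex_bij_betw_nat_finite[of "UNIV :: 'n set"] by (auto simp: atLeast0LessThan)
  have e_inj: "e i = e j \<longleftrightarrow> i = j" if "i < card (UNIV :: 'n set)" "j < card (UNIV :: 'n set)" for i j
    using e that by (auto simp: bij_betw_def inj_on_def)
  have e_sum: "(\<Sum>l\<in>UNIV. h l) = (\<Sum>l<card (UNIV :: 'n set). h (e l))" for h :: "'n \<Rightarrow> ('n, 'k) spoly"
    using sum.reindex_bij_betw[OF e, of h] by simp
  have "\<exists>r. \<forall>l. (if l = i then q else 0) = (\<Sum>j<n. r j * b j l)" for i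
  proof -
    have "\<forall>\<theta>\<in>D. \<exists>r. \<forall>i. \<theta> i = (\<Sum>j<n. r j * b j i)" using b by (simp add: poly_basis_def)
    from bspec[OF this q(2)] show ?thesis .
  qed
  then have "\<exists>r. \<forall>i l. (if l = i then q else 0) = (\<Sum>j<n. r i j * b j l)"
    by (intro choice allI)
  then obtain r where r: "\<And>i l. (\<Sum>j<n. r i j * b j l) = (if l = i then q else 0)"
    by metis
  have "\<not> n < card (UNIV :: 'n set)"
  proof
    assume "n < card (UNIV :: 'n set)"
    then have "q ^ card (UNIV :: 'n set) = 0"
      by (rule scalar_matrix_factor_narrow[rotated, where f = "\<lambda>i j. b j (e i)" and g = "\<lambda>j i. r (e i) j"])
         (use r e_inj in \<open>simp add: mult.commute\<close>)
    then show False using spoly_power_nonzero[OF q(1)] by blast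
  qed
  moreover have "\<not> card (UNIV :: 'n set) < n"
  proof
    assume lt: "card (UNIV :: 'n set) < n"
    \<comment> \<open>The product in the reverse order: both sides are coefficient vectors
      expressing q times \<open>b j'\<close> in the basis, hence equal by independence.\<close>
    have eq: "(\<Sum>l\<in>UNIV. b j' l * r l j) = (if j' = j then q else 0)" if "j' < n" "j < n" for j' j
    proof -
      have "(\<Sum>j<n. ((\<Sum>l\<in>UNIV. b j' l * r l j) - (if j' = j then q else 0)) * b j i) = 0" for i
      proof -
        have "(\<Sum>j<n. (\<Sum>l\<in>UNIV. b j' l * r l j) * b j i) = (\<Sum>l\<in>UNIV. b j' l * (\<Sum>j<n. r l j * b j i))"
          by (simp add: sum_distrib_left sum_distrib_right mult.assoc) (rule sum.swap)
        also have "\<dots> = b j' i * q"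
          by (simp add: r if_distrib cong: if_cong)
        also have "\<dots> = (\<Sum>j<n. (if j' = j then q else 0) * b j i)"
          using that(1) by (simp add: if_zero_mult mult.commute[of q])
        finally show ?thesis by (simp add: left_diff_distrib sum_subtractf)
      qed
      from poly_basis_indep[OF b this that(2)] show ?thesis by simp
    qed
    have "q ^ n = 0"
      by (rule scalar_matrix_factor_narrow[OF _ lt, where f = "\<lambda>j l. b j (e l)" and g = "\<lambda>l j. r (e l) j"])
         (use eq e_sum in simp)
    then show False using spoly_power_nonzero[OF q(1)] by blast
  qed
  ultimately show ?thesis by simp
qed

section \<open>Multiarrangements and their defining polynomials\<close>

locale multiarrangement =
  fixes A :: "('n::finite \<Rightarrow> 'k::field) set set" and m :: "('n \<Rightarrow> 'k) set \<Rightarrow> nat"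
  assumes multiarr: "multiarr {} A m"
begin

abbreviation \<alpha> :: "('n \<Rightarrow> 'k) set \<Rightarrow> 'n \<Rightarrow> 'k" where "\<alpha> \<equiv> dform {}"

abbreviation p :: "('n \<Rightarrow> 'k) set \<Rightarrow> ('n, 'k) spoly" where "p H \<equiv> lin_poly (\<alpha> H)"

definition Q :: "('n, 'k) spoly" where "Q = (\<Prod>H\<in>A. p H ^ m H)"

definition Q_omit :: "('n \<Rightarrow> 'k) set \<Rightarrow> ('n, 'k) spoly" where
  "Q_omit H = (\<Prod>H'\<in>A - {H}. p H' ^ m H')"

lemma finite_A: "finite A"
  using multiarr by (simp add: multiarr_def)

lemma \<alpha>_kernel:
  assumes "H \<in> A"
  shows "H = {v. lf (\<alpha> H) v = 0}" "H \<noteq> UNIV"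
proof -
  have "\<exists>a. H = {v \<in> Wsp {}. lf a v = 0} \<and> H \<noteq> Wsp {}"
    using multiarr assms by (auto simp: multiarr_def is_hyperplane_def)
  from someI_ex[OF this] have h: "H = {v \<in> Wsp {}. lf (\<alpha> H) v = 0}" "H \<noteq> Wsp {}"
    unfolding dform_def by (rule conjunct1, rule conjunct2)
  show "H = {v. lf (\<alpha> H) v = 0}" by (rule trans[OF h(1)]) (simp add: Wsp_def)
  show "H \<noteq> UNIV" using h(2) by (simp add: Wsp_def)
qed

lemma \<alpha>_nonzero:
  assumes "H \<in> A"
  shows "\<alpha> H \<noteq> (\<lambda>_. 0)"
proof
  assume "\<alpha> H = (\<lambda>_. 0)"
  then have "{v. lf (\<alpha> H) v = 0} = UNIV" by (simp add: lf_def)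
  then show False using \<alpha>_kernel[OF assms] by metis
qed

text \<open>Containment of kernels makes \<open>\<alpha> H'\<close> a multiple of
  \<open>\<alpha> H\<close>, by a nonzero scalar because \<open>\<alpha> H'\<close> is nonzero. This
  is what makes the primes \<open>p H\<close> pairwise non-associated.\<close>

lemma hyperplane_subset_eq:
  assumes "H \<in> A" "H' \<in> A" "H \<subseteq> H'"
  shows "H = H'"
proof -
  obtain k where k: "\<alpha> H k \<noteq> 0" using \<alpha>_nonzero[OF assms(1)] by auto
  define c where "c = \<alpha> H' k / \<alpha> H k"
  have eq: "\<alpha> H' = (\<lambda>i. c * \<alpha> H i)" unfolding c_def
  proof (rule lf_kernel_subset)
    show "\<alpha> H k \<noteq> 0" by (rule k)
    show "lf (\<alpha> H') v = 0" if "lf (\<alpha> H) v = 0" for v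
      using that assms \<alpha>_kernel(1)[of H] \<alpha>_kernel(1)[of H'] by blast
  qed
  have "lf (\<alpha> H') v = c * lf (\<alpha> H) v" for v
    by (subst eq) (rule lf_scale)
  moreover have "c \<noteq> 0" using \<alpha>_nonzero[OF assms(2)] eq by auto
  ultimately have "{v. lf (\<alpha> H) v = 0} = {v. lf (\<alpha> H') v = 0}" by simp
  then show ?thesis using \<alpha>_kernel(1)[OF assms(1)] \<alpha>_kernel(1)[OF assms(2)] by metis
qed

lemma prime_p: "H \<in> A \<Longrightarrow> prime_elem (p H)"
  by (simp add: prime_elem_lin_poly \<alpha>_nonzero)

lemma p_not_dvd: "H \<in> A \<Longrightarrow> H' \<in> A \<Longrightarrow> H \<noteq> H' \<Longrightarrow> \<not> p H dvd p H'"
  using hyperplane_subset_eq[of H H'] \<alpha>_kernel(1)[of H] \<alpha>_kernel(1)[of H'] lin_poly_dvd_kernel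
  by blast

lemma Q_eq: "H \<in> A \<Longrightarrow> Q = p H ^ m H * Q_omit H"
  unfolding Q_def Q_omit_def by (rule prod.remove[OF finite_A])

lemma p_not_dvd_Q_omit: "H \<in> A \<Longrightarrow> \<not> p H dvd Q_omit H"
  unfolding Q_omit_def
  by (rule prime_not_dvd_prod[OF prime_p]) (use p_not_dvd prime_elem_dvd_power prime_p in blast)+

lemma Q_nonzero: "Q \<noteq> 0"
  unfolding Q_def by (intro spoly_prod_nonzero spoly_power_nonzero) (use prime_p in force)

lemma Q_omit_nonzero: "Q_omit H \<noteq> 0"
  unfolding Q_omit_def by (intro spoly_prod_nonzero spoly_power_nonzero) (use prime_p in force)

lemma hom_Q: "hom_or_zero Q (\<Sum>H\<in>A. m H)"
proof -
  have "hom_or_zero (p H ^ m H) (m H)" for H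
    using hom_or_zero_power[OF hom_or_zero_lin_poly, of "\<alpha> H" "m H"] by simp
  then show ?thesis unfolding Q_def by (intro hom_or_zero_prod)
qed

lemma p_power_dvd_Q: "H \<in> A \<Longrightarrow> p H ^ m H dvd Q"
  by (simp add: Q_eq)

lemma p_power_dvd_Q_omit: "H' \<in> A \<Longrightarrow> H' \<noteq> H \<Longrightarrow> p H' ^ m H' dvd Q_omit H"
  unfolding Q_omit_def by (intro dvd_prodI) (auto simp: finite_A)

text \<open>Q times a partial derivative. These derivations show that D(A,m) has full rank, and they
  provide the crude bound on the determinant of a basis.\<close>

lemma Q_derivation: "(\<lambda>l. if l = i then Q else 0) \<in> Dmod {} A m"
  unfolding Dmod_empty_iff dapp_def
  by (auto intro!: dvd_sum dvd_mult dest: p_power_dvd_Q)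

lemma basis_card: "poly_basis (Dmod {} A m) n b \<Longrightarrow> n = card (UNIV :: 'n set)"
  using poly_basis_card Q_nonzero Q_derivation by blast

end

section \<open>The determinant of a basis divides the defining polynomial\<close>

lemma coord_bij_inj:
  "bij_betw e {..<n} (UNIV :: 'n set) \<Longrightarrow> i < n \<Longrightarrow> j < n \<Longrightarrow> e i = e j \<longleftrightarrow> i = j"
  by (auto simp: bij_betw_def inj_on_def)

lemma dapp_coord:
  fixes c :: "'n::finite \<Rightarrow> 'k::field"
  assumes "bij_betw e {..<n} (UNIV :: 'n set)"
  shows "dapp \<theta> c = (\<Sum>l<n. const_poly (c (e l)) * \<theta> (e l))"
  unfolding dapp_def by (rule sum.reindex_bij_betw[OF assms, symmetric])

text \<open>Trades one row of a coefficient matrix for the values of the derivations on a linear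
  form, with explicit control of the determinant: the left factor is the identity with one row
  replaced by the coefficients of the form.\<close>

lemma row_replace_mat:
  fixes c :: "'n::finite \<Rightarrow> 'k::field"
  assumes "bij_betw e {..<n} (UNIV :: 'n set)"
  shows "mat n n (\<lambda>(i, l). if i = r then const_poly (c (e l)) else if i = l then 1 else 0) *
      mat n n (\<lambda>(i, j). b j (e i)) = mat n n (\<lambda>(i, j). if i = r then dapp (b j) c else b j (e i))"
  unfolding mat_mult_fun by (rule eq_matI) (auto simp: dapp_coord[OF assms] if_zero_mult)

lemma det_row_form:
  fixes c :: "'n::finite \<Rightarrow> 'k::field"
  assumes e: "bij_betw e {..<n} (UNIV :: 'n set)" and n: "n > 0"
  shows "det (mat n n (\<lambda>(i, j). if i = 0 then dapp (b j) c else b j (e i))) =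
    const_poly (c (e 0)) * det (mat n n (\<lambda>(i, j). b j (e i)))"
proof -
  let ?T = "mat n n (\<lambda>(i, l). if i = 0 then const_poly (c (e l)) else if i = l then 1 else 0) :: ('n, 'k) spoly mat"
  have "det ?T = (\<Prod>i<n. ?T $$ (i, i))"
    by (subst det_upper_triangular[where n = n])
       (auto simp: upper_triangular_def prod_list_diag_prod atLeast0LessThan)
  also have "\<dots> = (\<Prod>i<n. if i = 0 then const_poly (c (e 0)) else 1)"
    by (intro prod.cong) auto
  also have "\<dots> = const_poly (c (e 0))" using n by simp
  finally show ?thesis
    unfolding row_replace_mat[OF e, symmetric] by (subst det_mult[where n = n]) auto
qed

text \<open>Expanding the \<open>\<eta> j\<close> in the basis factors their coefficient matrix
  through that of the basis.\<close>

lemma det_basis_dvd: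
  assumes b: "poly_basis D n b" and \<eta>: "\<And>j. j < n \<Longrightarrow> \<eta> j \<in> D"
  shows "det (mat n n (\<lambda>(i, j). b j (e i))) dvd det (mat n n (\<lambda>(i, j). \<eta> j (e i)))"
proof -
  have "\<exists>r. \<forall>l. \<eta> j l = (\<Sum>k<n. r k * b k l)" if "j < n" for j
    using b \<eta>[OF that] unfolding poly_basis_def by blast
  then obtain r where r: "\<And>j l. j < n \<Longrightarrow> \<eta> j l = (\<Sum>k<n. r j k * b k l)" by metis
  have eq: "mat n n (\<lambda>(i, j). \<eta> j (e i)) = mat n n (\<lambda>(i, j). b j (e i)) * mat n n (\<lambda>(i, j). r j i)"
    unfolding mat_mult_fun by (rule eq_matI) (auto simp: r mult.commute)
  show ?thesis by (simp add: eq det_mult[where n = n])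
qed

lemma det_zero_row_minor:
  fixes f :: "nat \<Rightarrow> nat \<Rightarrow> 'a::comm_ring_1"
  assumes "\<And>j. 0 < j \<Longrightarrow> j < Suc n \<Longrightarrow> f 0 j = 0"
  shows "det (mat (Suc n) (Suc n) (\<lambda>(i, j). f i j)) = f 0 0 * det (mat n n (\<lambda>(i, j). f (Suc i) (Suc j)))"
proof -
  let ?M = "mat (Suc n) (Suc n) (\<lambda>(i, j). f i j)"
  have "det ?M = (\<Sum>j<Suc n. ?M $$ (0, j) * cofactor ?M 0 j)"
    by (rule laplace_expansion_row) auto
  also have "\<dots> = (\<Sum>j<Suc n. if j = 0 then f 0 0 * cofactor ?M 0 0 else 0)"
    using assms by (intro sum.cong) auto
  also have "\<dots> = f 0 0 * cofactor ?M 0 0" by simp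
  also have "mat_delete ?M 0 0 = mat n n (\<lambda>(i, j). f (Suc i) (Suc j))"
    by (rule eq_matI) (auto simp: mat_delete_def)
  then have "cofactor ?M 0 0 = det (mat n n (\<lambda>(i, j). f (Suc i) (Suc j)))"
    by (simp add: cofactor_def)
  finally show ?thesis .
qed

context multiarrangement
begin

text \<open>Compares the basis with n derivations that become diagonal once row s is replaced by the
  values on \<open>\<alpha> H\<close>. Only one diagonal entry involves \<open>p H\<close>, and it
  does so with exponent exactly \<open>m H\<close>.\<close>

lemma adapted_derivations_det:
  assumes H: "H \<in> A" and e: "bij_betw e {..<n} (UNIV :: 'n set)" and b: "poly_basis (Dmod {} A m) n b"
  shows "\<exists>Z. \<not> p H dvd Z \<and> det (mat n n (\<lambda>(i, j). b j (e i))) dvd p H ^ m H * Z"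
proof -
  define c where "c = \<alpha> H"
  obtain k where k: "c k \<noteq> 0" using \<alpha>_nonzero[OF H] by (auto simp: c_def)
  obtain s where s: "s < n" "e s = k" using e by (metis UNIV_I bij_betwE bij_betw_iff_bijections lessThan_iff)
  \<comment> \<open>For j other than s the combination of partials kills \<open>\<alpha> H\<close>,
    so the factor \<open>Q_omit H\<close> suffices for membership in D(A,m); \<open>Q\<close> itself
    is spent only on the direction k transversal to H.\<close>
  define \<eta> where "\<eta> j = (if j = s then (\<lambda>l. if l = k then Q else 0) else
    (\<lambda>l. (if l = e j then const_poly (c k) * Q_omit H else 0)
       - (if l = k then const_poly (c (e j)) * Q_omit H else 0)))" for j
  have dapp_\<eta>: "dapp (\<eta> j) a = (if j = s then const_poly (a k) * Q else
     const_poly (a (e j) * c k - a k * c (e j)) * Q_omit H)" for j a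
    by (simp add: \<eta>_def dapp_diff dapp_delta left_diff_distrib const_poly_diff const_poly_mult mult.assoc)
  have \<eta>_D: "\<eta> j \<in> Dmod {} A m" for j
    unfolding Dmod_empty_iff dapp_\<eta>
  proof
    fix H' assume "H' \<in> A"
    then show "p H' ^ m H' dvd (if j = s then const_poly (\<alpha> H' k) * Q else
        const_poly (\<alpha> H' (e j) * c k - \<alpha> H' k * c (e j)) * Q_omit H)"
      using p_power_dvd_Q[of H'] p_power_dvd_Q_omit[of H' H]
      by (cases "H' = H") (simp_all add: c_def mult.commute[of "\<alpha> H k"] dvd_mult)
  qed
  have diag: "(if i = s then dapp (\<eta> j) c else \<eta> j (e i)) =
      (if i = j then const_poly (c k) * Q_omit H * (if i = s then p H ^ m H else 1) else 0)"
    if "i < n" "j < n" for i j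
  proof (cases "i = s")
    case True
    then show ?thesis by (auto simp: dapp_\<eta> Q_eq[OF H] mult_ac)
  next
    case False
    then show ?thesis
      using that s coord_bij_inj[OF e, of i j] coord_bij_inj[OF e, of i s] by (auto simp: \<eta>_def)
  qed
  let ?T = "mat n n (\<lambda>(i, l). if i = s then const_poly (c (e l)) else if i = l then 1 else 0) :: ('n, 'k) spoly mat"
  let ?N = "mat n n (\<lambda>(i, j). \<eta> j (e i))"
  have "?T * ?N = mat n n (\<lambda>(i, j). if i = j
      then const_poly (c k) * Q_omit H * (if i = s then p H ^ m H else 1) else 0)"
    unfolding row_replace_mat[OF e] by (rule eq_matI) (use diag in auto)
  then have "det ?T * det ?N = (\<Prod>i<n. const_poly (c k) * Q_omit H * (if i = s then p H ^ m H else 1))"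
    by (subst det_mult[where n = n, symmetric]) (auto simp: det_diagonal)
  also have "\<dots> = p H ^ m H * (const_poly (c k) * Q_omit H) ^ n"
    using s(1) by (simp add: prod.distrib mult.commute)
  finally have TN: "det ?T * det ?N = p H ^ m H * (const_poly (c k) * Q_omit H) ^ n" .
  have "det (mat n n (\<lambda>(i, j). b j (e i))) dvd det ?N"
    by (rule det_basis_dvd[OF b]) (rule \<eta>_D)
  then have "det (mat n n (\<lambda>(i, j). b j (e i))) dvd p H ^ m H * (const_poly (c k) * Q_omit H) ^ n"
    unfolding TN[symmetric] by (rule dvd_mult)
  moreover have "\<not> p H dvd (const_poly (c k) * Q_omit H) ^ n"
  proof
    assume "p H dvd (const_poly (c k) * Q_omit H) ^ n"
    then have "p H dvd const_poly (c k) * Q_omit H" by (rule prime_elem_dvd_power[OF prime_p[OF H]])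
    then have "p H dvd const_poly (c k)"
      using prime_elem_dvd_multD[OF prime_p[OF H]] p_not_dvd_Q_omit[OF H] by blast
    then show False
      using const_poly_dvd_1[OF k] prime_elem_not_unit[OF prime_p[OF H]] dvd_trans by blast
  qed
  ultimately show ?thesis by blast
qed

text \<open>Comparison with Q times the partial derivatives bounds the determinant by
  \<open>Q ^ n\<close>; the adapted derivations at each H cut the exponent of \<open>p H\<close>
  down to \<open>m H\<close>.\<close>

lemma det_basis_dvd_Q:
  assumes e: "bij_betw e {..<n} (UNIV :: 'n set)" and b: "poly_basis (Dmod {} A m) n b"
  shows "det (mat n n (\<lambda>(i, j). b j (e i))) dvd Q"
  unfolding Q_def
proof (rule dvd_prod_reduce_exponents[OF finite_A prime_p])
  have "det (mat n n (\<lambda>(i, j). b j (e i))) dvd det (mat n n (\<lambda>(i, j). if e i = e j then Q else 0))"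
    by (rule det_basis_dvd[OF b, where \<eta> = "\<lambda>j l. if l = e j then Q else 0"]) (rule Q_derivation)
  also have "mat n n (\<lambda>(i, j). if e i = e j then Q else 0) = mat n n (\<lambda>(i, j). if i = j then Q else 0)"
    by (rule eq_matI) (auto simp: coord_bij_inj[OF e])
  also have "det \<dots> = (\<Prod>H\<in>A. p H ^ (m H * n))"
    by (simp add: det_diagonal Q_def prod_power_distrib power_mult)
  finally show "det (mat n n (\<lambda>(i, j). b j (e i))) dvd (\<Prod>H\<in>A. p H ^ (m H * n))" .
  show "n > 0" using basis_card[OF b] by (simp add: card_gt_0_iff)
  show "\<exists>Z. \<not> p H dvd Z \<and> det (mat n n (\<lambda>(i, j). b j (e i))) dvd p H ^ m H * Z" if "H \<in> A" for H
    by (rule adapted_derivations_det[OF that e b])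
qed

lemma det_row_form_dvd_Q:
  assumes e: "bij_betw e {..<n} (UNIV :: 'n set)" and b: "poly_basis (Dmod {} A m) n b"
    and c: "c (e 0) \<noteq> 0"
  shows "det (mat n n (\<lambda>(i, j). if i = 0 then dapp (b j) c else b j (e i))) dvd Q"
proof -
  have "n > 0" using basis_card[OF b] by (simp add: card_gt_0_iff)
  then show ?thesis
    using det_basis_dvd_Q[OF e b] const_poly_dvd_1[OF c] mult_dvd_mono[of "const_poly (c (e 0))" 1]
    by (simp add: det_row_form[OF e])
qed

end

section \<open>The good summand\<close>

lemma poly_basis_span:
  assumes "poly_basis D n b" "\<theta> \<in> D"
  obtains r where "\<And>i. \<theta> i = (\<Sum>j<n. r j * b j i)"
  using assms unfolding poly_basis_def by blast

lemma poly_basis_transpose: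
  assumes b: "poly_basis D n b" and j: "j < n"
  shows "poly_basis D n (b \<circ> transpose 0 j)"
proof -
  let ?t = "transpose 0 j"
  have t: "bij_betw ?t {..<n} {..<n}"
    using j by (intro bij_betwI[where g = ?t]) (auto simp: transpose_def)
  have re: "(\<Sum>l<n. r (?t l) * b (?t l) i) = (\<Sum>l<n. r l * b l i)" for r i
    by (rule sum.reindex_bij_betw[OF t])
  have tn: "?t l < n" if "l < n" for l
    using that j by (auto simp: transpose_def)
  have "\<exists>r. \<forall>i. \<theta> i = (\<Sum>l<n. r l * (b \<circ> ?t) l i)" if \<theta>: "\<theta> \<in> D" for \<theta>
  proof -
    obtain r where "\<And>i. \<theta> i = (\<Sum>l<n. r l * b l i)" using poly_basis_span[OF b \<theta>] by blast
    then show ?thesis using re[of r] by (intro exI[of _ "r \<circ> ?t"]) simp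
  qed
  moreover have "r l = 0" if "\<forall>i. (\<Sum>l<n. r l * (b \<circ> ?t) l i) = 0" "l < n" for r l
  proof -
    have "(\<Sum>l<n. (r \<circ> ?t) l * b l i) = 0" for i
      using that(1) re[of "r \<circ> ?t" i] by simp
    from poly_basis_indep[OF b this tn[OF that(2)]] show ?thesis by simp
  qed
  moreover have "(b \<circ> ?t) l \<in> D" if "l < n" for l
    using b tn[OF that] by (simp add: poly_basis_def)
  ultimately show ?thesis unfolding poly_basis_def by blast
qed

lemma poly_basis_elementary:
  fixes D :: "('n::finite \<Rightarrow> ('n, 'k::field) spoly) set"
  assumes b: "poly_basis D (Suc n) b" and c: "c \<noteq> 0"
    and mult: "\<And>f \<theta>. \<theta> \<in> D \<Longrightarrow> (\<lambda>i. f * \<theta> i) \<in> D"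
    and diff: "\<And>\<theta> \<eta>. \<theta> \<in> D \<Longrightarrow> \<eta> \<in> D \<Longrightarrow> (\<lambda>i. \<theta> i - \<eta> i) \<in> D"
  shows "poly_basis D (Suc n) (\<lambda>j i. if j = 0 then const_poly c * b 0 i else b j i - g j * b 0 i)"
    (is "poly_basis D _ ?b")
proof -
  have bD: "b j \<in> D" if "j < Suc n" for j using b that by (simp add: poly_basis_def)
  have "?b j \<in> D" if "j < Suc n" for j
    using mult[OF bD[of 0]] diff[OF bD[OF that] mult[OF bD[of 0]]] by (cases "j = 0") auto
  moreover have "\<exists>r. \<forall>i. \<theta> i = (\<Sum>j<Suc n. r j * ?b j i)" if \<theta>: "\<theta> \<in> D" for \<theta>
  proof -
    obtain r where r: "\<And>i. \<theta> i = (\<Sum>j<Suc n. r j * b j i)" using poly_basis_span[OF b \<theta>] by blast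
    \<comment> \<open>Since \<open>b j\<close> is the new element plus \<open>g j * b 0\<close>, the
      coefficient at 0 collects the terms \<open>r j * g j\<close> and is then rescaled; the
      definition of \<open>r'\<close> in the independence proof below inverts this.\<close>
    define r' where "r' j = (if j = 0 then const_poly (inverse c) * (r 0 + (\<Sum>j<n. r (Suc j) * g (Suc j))) else r j)" for j
    have "\<theta> i = (\<Sum>j<Suc n. r' j * ?b j i)" for i
    proof -
      have "r' 0 * ?b 0 i = (const_poly (inverse c) * const_poly c) * ((r 0 + (\<Sum>j<n. r (Suc j) * g (Suc j))) * b 0 i)"
        by (simp add: r'_def mult_ac)
      also have "\<dots> = r 0 * b 0 i + (\<Sum>j<n. r (Suc j) * g (Suc j) * b 0 i)"
        by (simp add: const_poly_inverse[OF c] distrib_right sum_distrib_right)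
      finally show ?thesis
        unfolding r sum.lessThan_Suc_shift
        by (simp add: r'_def right_diff_distrib sum_subtractf mult.assoc)
    qed
    then show ?thesis by blast
  qed
  moreover have "r j = 0" if r: "\<forall>i. (\<Sum>j<Suc n. r j * ?b j i) = 0" and j: "j < Suc n" for r j
  proof -
    define r' where "r' j = (if j = 0 then const_poly c * r 0 - (\<Sum>j<n. r (Suc j) * g (Suc j)) else r j)" for j
    have "(\<Sum>j<Suc n. r' j * b j i) = (\<Sum>j<Suc n. r j * ?b j i)" for i
      unfolding sum.lessThan_Suc_shift
      by (simp add: r'_def left_diff_distrib right_diff_distrib sum_subtractf sum_distrib_left mult_ac)
    then have r'0: "r' j = 0" if "j < Suc n" for j
      using poly_basis_indep[OF b _ that, of r'] r by simp
    have pos: "r (Suc l) = 0" if "l < n" for l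
      using r'0[of "Suc l"] that by (simp add: r'_def)
    then have z: "const_poly c * r 0 = 0" using r'0[of 0] by (simp add: r'_def)
    have "r 0 = const_poly (inverse c) * (const_poly c * r 0)"
      by (simp add: const_poly_inverse[OF c] flip: mult.assoc)
    then have "r 0 = 0" using z by simp
    then show ?thesis using pos j by (cases j) auto
  qed
  ultimately show ?thesis unfolding poly_basis_def by blast
qed

lemma dvd_const_mult_iff:
  assumes "c \<noteq> 0"
  shows "f dvd const_poly c * g \<longleftrightarrow> f dvd g"
proof
  assume "f dvd const_poly c * g"
  then have "f dvd const_poly (inverse c) * (const_poly c * g)" by (rule dvd_mult)
  then show "f dvd g" by (simp add: const_poly_inverse[OF assms] flip: mult.assoc)
qed (rule dvd_mult)

lemma coord_bij_starting_at:
  obtains e :: "nat \<Rightarrow> 'n::finite" where "bij_betw e {..<card (UNIV :: 'n set)} UNIV" "e 0 = k"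
proof -
  let ?n = "card (UNIV :: 'n set)"
  obtain e :: "nat \<Rightarrow> 'n" where e: "bij_betw e {..<?n} UNIV"
    using ex_bij_betw_nat_finite[of "UNIV :: 'n set"] by (auto simp: atLeast0LessThan)
  then have "bij_betw (transpose (e 0) k \<circ> e) {..<?n} UNIV"
    by (rule bij_betw_trans) simp
  then show ?thesis by (rule that) simp
qed

text \<open>The coordinate \<open>k\<close>, in which the form of \<open>H0\<close> does not vanish,
  is numbered 0. The others, \<open>e (Suc i)\<close> for i < n, serve as coordinates on
  \<open>H0\<close>, so V has dimension \<open>Suc n\<close>.\<close>

locale pointed_multiarrangement = multiarrangement A m
  for A :: "('n::finite \<Rightarrow> 'k::field) set set" and m +
  fixes H0 :: "('n \<Rightarrow> 'k) set" and k :: 'n and e :: "nat \<Rightarrow> 'n" and n :: nat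
  assumes H0: "H0 \<in> A" and k: "dform {} H0 k \<noteq> 0"
    and e: "bij_betw e {..<Suc n} UNIV" and e0: "e 0 = k"
begin

abbreviation restr_form :: "('n \<Rightarrow> 'k) \<Rightarrow> ('n \<Rightarrow> 'k)" where "restr_form \<equiv> lred (\<alpha> H0) k"

lemma dapp_no_k:
  assumes "c k = 0"
  shows "dapp \<theta> c = (\<Sum>i<n. const_poly (c (e (Suc i))) * \<theta> (e (Suc i)))"
  unfolding dapp_coord[OF e] sum.lessThan_Suc_shift using assms e0 by simp

lemma coord_nonzero:
  assumes "c k = 0" "c \<noteq> (\<lambda>_. 0)"
  obtains i where "i < n" "c (e (Suc i)) \<noteq> 0"
proof -
  obtain l where l: "c l \<noteq> 0" using assms(2) by auto
  obtain i where i: "i < Suc n" "e i = l"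
    using e by (metis UNIV_I bij_betw_iff_bijections lessThan_iff)
  with l assms(1) e0 have "i \<noteq> 0" by metis
  then show ?thesis using that[of "i - 1"] i l by simp
qed

lemma restr_form_nonzero:
  assumes "H \<in> A" "H \<noteq> H0"
  shows "restr_form (\<alpha> H) \<noteq> (\<lambda>_. 0)"
proof
  assume "restr_form (\<alpha> H) = (\<lambda>_. 0)"
  then have "lin_poly (restr_form (\<alpha> H)) = 0" by (simp add: lin_poly_eq_0_iff)
  then have "p H = const_poly (\<alpha> H k / \<alpha> H0 k) * p H0" by (simp add: lin_poly_lred)
  then have "p H0 dvd p H" by simp
  then show False using p_not_dvd[OF H0 assms(1)] assms(2) by blast
qed

text \<open>A derivation killing \<open>\<alpha> H0\<close> takes the same value on
  \<open>\<alpha> H\<close> and on its reduction, which avoids the coordinate \<open>k\<close>. So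
  the reduced form combines the rows of the minor to multiples of \<open>p H ^ m H\<close>, and
  since it has a nonzero coefficient, that power divides the minor.\<close>

lemma Q_omit_dvd_minor:
  assumes b: "\<And>j. j < n \<Longrightarrow> b j \<in> Dmod {} A m" "\<And>j. j < n \<Longrightarrow> dapp (b j) (\<alpha> H0) = 0"
  shows "Q_omit H0 dvd det (mat n n (\<lambda>(i, j). b j (e (Suc i))))"
  unfolding Q_omit_def
proof (rule prod_prime_powers_dvd)
  fix H assume "H \<in> A - {H0}"
  then have H: "H \<in> A" "H \<noteq> H0" by auto
  let ?c = "restr_form (\<alpha> H)"
  have c: "?c k = 0" using k by simp
  obtain l where l: "l < n" "?c (e (Suc l)) \<noteq> 0"
    using coord_nonzero[OF c restr_form_nonzero[OF H]] by blast
  have "p H ^ m H dvd const_poly (?c (e (Suc l))) * det (mat n n (\<lambda>(i, j). b j (e (Suc i))))"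
  proof (rule dvd_mult_det[where n = n and c = "\<lambda>i. const_poly (?c (e (Suc i)))"])
    fix j assume j: "j < n"
    have "(\<Sum>i<n. const_poly (?c (e (Suc i))) * mat n n (\<lambda>(i, j). b j (e (Suc i))) $$ (i, j)) = dapp (b j) ?c"
      using j by (simp add: dapp_no_k[of ?c, OF c])
    also have "\<dots> = dapp (b j) (\<alpha> H)" by (simp add: dapp_lred b(2)[OF j])
    finally show "p H ^ m H dvd (\<Sum>i<n. const_poly (?c (e (Suc i))) * mat n n (\<lambda>(i, j). b j (e (Suc i))) $$ (i, j))"
      using b(1)[OF j] H(1) by (simp add: Dmod_empty_iff)
  qed (use l in auto)
  then show "p H ^ m H dvd det (mat n n (\<lambda>(i, j). b j (e (Suc i))))"
    using dvd_const_mult_iff[OF l(2)] by blast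
qed (use finite_A prime_p p_not_dvd in auto)

text \<open>After row 0 is replaced by the values on \<open>\<alpha> H0\<close>, only its first
  entry survives; \<open>p H0 ^ m H0\<close> is cancelled from the resulting divisor of
  \<open>Q\<close>.\<close>

lemma minor_dvd_Q_omit:
  assumes b: "poly_basis (Dmod {} A m) (Suc n) b" and f: "dapp (b 0) (\<alpha> H0) = p H0 ^ m H0 * f"
    and 0: "\<And>j. 0 < j \<Longrightarrow> j < Suc n \<Longrightarrow> dapp (b j) (\<alpha> H0) = 0"
  shows "f * det (mat n n (\<lambda>(i, j). b (Suc j) (e (Suc i)))) dvd Q_omit H0"
proof -
  let ?N = "mat n n (\<lambda>(i, j). b (Suc j) (e (Suc i)))"
  have "det (mat (Suc n) (Suc n) (\<lambda>(i, j). if i = 0 then dapp (b j) (\<alpha> H0) else b j (e i))) =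
      p H0 ^ m H0 * (f * det ?N)"
    using det_zero_row_minor[of n "\<lambda>i j. if i = 0 then dapp (b j) (\<alpha> H0) else b j (e i)"] 0 f
    by (simp add: mult.assoc)
  then have "p H0 ^ m H0 * (f * det ?N) dvd p H0 ^ m H0 * Q_omit H0"
    using det_row_form_dvd_Q[OF e b, of "\<alpha> H0"] k e0 Q_eq[OF H0] by simp
  then show ?thesis
    by (rule spoly_dvd_mult_cancel[rotated]) (intro spoly_power_nonzero, use prime_p[OF H0] in auto)
qed

text \<open>The element of degree \<open>m H0\<close> is moved from position j0 to position 0 and
  scaled to a good summand, which then clears the values of the others on
  \<open>\<alpha> H0\<close>. The degrees are only permuted.\<close>

lemma normalized_basis:
  assumes b: "poly_basis (Dmod {} A m) (Suc n) b"
    and hom: "\<And>j i. j < Suc n \<Longrightarrow> hom_or_zero (b j i) (d j)"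
    and heavy: "heavy A m H0"
  obtains j0 b' where "j0 < Suc n" "poly_basis (Dmod {} A m) (Suc n) b'"
    "\<And>j i. j < Suc n \<Longrightarrow> hom_or_zero (b' j i) (d (transpose 0 j0 j))" "d j0 = m H0"
    "dapp (b' 0) (\<alpha> H0) = p H0 ^ m H0"
    "\<And>j. 0 < j \<Longrightarrow> j < Suc n \<Longrightarrow> dapp (b' j) (\<alpha> H0) = 0"
proof -
  let ?P = "p H0 ^ m H0"
  have P0: "?P \<noteq> 0" using prime_p[OF H0] by (intro spoly_power_nonzero) auto
  have homP: "hom_or_zero ?P (m H0)"
    using hom_or_zero_power[OF hom_or_zero_lin_poly, of "\<alpha> H0" "m H0"] by simp
  have "\<exists>f. dapp (b j) (\<alpha> H0) = ?P * f" if "j < Suc n" for j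
    using b that H0 unfolding poly_basis_def Dmod_empty_iff by (auto simp: dvd_def)
  then obtain f where f: "\<And>j. j < Suc n \<Longrightarrow> dapp (b j) (\<alpha> H0) = ?P * f j" by metis
  have homPf: "hom_or_zero (?P * f j) (d j)" if "j < Suc n" for j
    using hom_or_zero_dapp[of "b j" "d j" "\<alpha> H0"] hom[OF that] f[OF that] by simp
  have d_ge: "m H0 \<le> d j" if "j < Suc n" "f j \<noteq> 0" for j
    using hom_or_zero_dvd_le[OF _ homP homPf[OF that(1)]] spoly_mult_nonzero[OF P0 that(2)] by simp
  \<comment> \<open>The subtraction is truncated, but it can fall short only if
    \<open>f j = 0\<close>, where any degree is allowed.\<close>
  have homf: "hom_or_zero (f j) (d j - m H0)" if "j < Suc n" for j
  proof (cases "f j = 0")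
    case False
    then show ?thesis
      using hom_or_zero_cofactor[OF homP P0, of "f j" "d j - m H0"] homPf[OF that] d_ge[OF that] by simp
  qed simp
  \<comment> \<open>Values on a linear form keep the degree, so column j is still homogeneous of
    degree \<open>d j\<close>, and the determinant has the sum of the exponents as its
    degree.\<close>
  let ?M = "mat (Suc n) (Suc n) (\<lambda>(i, j). if i = 0 then dapp (b j) (\<alpha> H0) else b j (e i))"
  have MQ: "det ?M dvd Q" using det_row_form_dvd_Q[OF e b] k e0 by simp
  then have M0: "det ?M \<noteq> 0" using Q_nonzero by auto
  have "hom_or_zero (det ?M) (\<Sum>j<Suc n. d j)"
  proof (rule hom_or_zero_det)
    show "hom_or_zero (?M $$ (i, j)) (d j)" if "i < Suc n" "j < Suc n" for i j
      using that hom[OF that(2)] by (simp add: hom_or_zero_dapp)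
  qed simp
  then have "(\<Sum>j<Suc n. d j) \<le> (\<Sum>H\<in>A. m H)"
    using hom_or_zero_dvd_le[OF MQ _ hom_Q Q_nonzero] by blast
  with heavy have sum_d: "(\<Sum>j<Suc n. d j) \<le> 2 * m H0" by (simp add: heavy_def)
  have "\<exists>j<Suc n. f j \<noteq> 0"
  proof (rule ccontr)
    assume "\<not> ?thesis"
    then have "det ?M = (\<Sum>j<Suc n. 0)"
      by (subst laplace_expansion_row[of _ "Suc n" 0]) (auto simp: f)
    with M0 show False by simp
  qed
  then obtain j1 where j1: "j1 < Suc n" "f j1 \<noteq> 0" by blast
  have dj1: "d j1 = m H0"
  proof (cases "\<exists>j2<Suc n. j2 \<noteq> j1 \<and> f j2 \<noteq> 0")
    case True
    then obtain j2 where j2: "j2 < Suc n" "j2 \<noteq> j1" "f j2 \<noteq> 0" by blast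
    have "d j1 + d j2 = sum d {j1, j2}" using j2 by simp
    also have "\<dots> \<le> (\<Sum>j<Suc n. d j)" using j1 j2 by (intro sum_mono2) auto
    finally show ?thesis using sum_d d_ge[OF j1] d_ge[OF j2(1,3)] by linarith
  next
    case False
    let ?b = "b \<circ> transpose 0 j1"
    have b1: "poly_basis (Dmod {} A m) (Suc n) ?b" by (rule poly_basis_transpose[OF b j1(1)])
    have 0: "dapp (?b j) (\<alpha> H0) = 0" if "0 < j" "j < Suc n" for j
    proof -
      have "transpose 0 j1 j < Suc n" "transpose 0 j1 j \<noteq> j1"
        using that j1(1) by (auto simp: transpose_def)
      then have "f (transpose 0 j1 j) = 0" using False by blast
      then show ?thesis using f[OF \<open>transpose 0 j1 j < Suc n\<close>] by simp
    qed
    let ?N = "mat n n (\<lambda>(i, j). ?b (Suc j) (e (Suc i)))"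
    have N1: "f j1 * det ?N dvd Q_omit H0"
      by (rule minor_dvd_Q_omit[OF b1 _ 0]) (simp add: f[OF j1(1)])
    have N2: "Q_omit H0 dvd det ?N"
      by (rule Q_omit_dvd_minor[where b = "\<lambda>j. ?b (Suc j)"]) (use b1 0 in \<open>auto simp: poly_basis_def\<close>)
    have "f j1 * Q_omit H0 dvd Q_omit H0"
      by (rule dvd_trans[OF mult_dvd_mono[OF dvd_refl N2] N1])
    then have "Q_omit H0 * f j1 dvd Q_omit H0 * 1" by (simp add: mult.commute)
    then have "f j1 dvd 1" by (rule spoly_dvd_mult_cancel[OF Q_omit_nonzero])
    then have "d j1 - m H0 \<le> 0"
      by (rule hom_or_zero_dvd_le) (use homf[OF j1(1)] in auto)
    with d_ge[OF j1] show ?thesis by simp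
  qed
  then obtain c where c: "f j1 = const_poly c"
    using hom_or_zero_0_const homf[OF j1(1)] by fastforce
  with j1 have c0: "c \<noteq> 0" by auto
  let ?t = "transpose 0 j1"
  let ?b = "b \<circ> ?t"
  have tn: "?t j < Suc n" if "j < Suc n" for j
    using that j1(1) by (auto simp: transpose_def)
  \<comment> \<open>The element now at position 0 takes the value \<open>?P * const_poly c\<close>
    on \<open>\<alpha> H0\<close>; subtracting \<open>g j\<close> times it therefore removes exactly
    \<open>?P * f (?t j)\<close>.\<close>
  define g where "g j = f (?t j) * const_poly (inverse c)" for j
  define b' where "b' j i = (if j = 0 then const_poly (inverse c) * ?b 0 i else ?b j i - g j * ?b 0 i)" for j i
  have "poly_basis (Dmod {} A m) (Suc n) (\<lambda>j i. if j = 0 then const_poly (inverse c) * ?b 0 i else ?b j i - g j * ?b 0 i)"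
    by (rule poly_basis_elementary[OF poly_basis_transpose[OF b j1(1)]])
       (use c0 in \<open>auto intro: Dmod_empty_diff Dmod_empty_mult\<close>)
  then have b': "poly_basis (Dmod {} A m) (Suc n) b'" by (simp add: b'_def[abs_def])
  have hom': "hom_or_zero (b' j i) (d (?t j))" if j: "j < Suc n" for j i
  proof (cases "j = 0")
    case True
    then show ?thesis using hom[OF j1(1)] by (simp add: b'_def hom_or_zero_const_mult)
  next
    case False
    \<comment> \<open>Degrees match: \<open>g j\<close> has degree \<open>d (?t j) - m H0\<close>,
      and \<open>?b 0\<close> has degree \<open>m H0\<close>.\<close>
    have "hom_or_zero (g j * ?b 0 i) (d (?t j))"
    proof (cases "f (?t j) = 0")
      case False
      have "hom_or_zero (f (?t j) * (const_poly (inverse c) * b j1 i)) (d (?t j) - m H0 + d j1)"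
        by (intro hom_or_zero_mult homf tn j hom_or_zero_const_mult hom j1)
      then show ?thesis using d_ge[OF tn[OF j] False] dj1 by (simp add: g_def mult.assoc)
    qed (simp add: g_def)
    then show ?thesis using False hom[OF tn[OF j]] by (simp add: b'_def hom_or_zero_diff)
  qed
  have b'0: "dapp (b' 0) (\<alpha> H0) = ?P"
  proof -
    have "dapp (b' 0) (\<alpha> H0) = const_poly (inverse c) * (?P * const_poly c)"
      by (simp add: b'_def[abs_def] dapp_mult f[OF j1(1)] c)
    also have "\<dots> = ?P * (const_poly (inverse c) * const_poly c)" by (simp only: mult_ac)
    finally show ?thesis by (simp add: const_poly_inverse[OF c0])
  qed
  have b'pos: "dapp (b' j) (\<alpha> H0) = 0" if j: "0 < j" "j < Suc n" for j
  proof -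
    have "dapp (b' j) (\<alpha> H0) = ?P * f (?t j) - f (?t j) * const_poly (inverse c) * (?P * const_poly c)"
      using j by (simp add: b'_def[abs_def] dapp_diff dapp_mult f[OF j1(1)] f[OF tn[OF j(2)]] c g_def)
    also have "\<dots> = ?P * f (?t j) - ?P * f (?t j) * (const_poly (inverse c) * const_poly c)"
      by (simp only: mult_ac)
    finally show ?thesis by (simp add: const_poly_inverse[OF c0])
  qed
  show ?thesis by (rule that[OF j1(1) b' hom' dj1 b'0 b'pos])
qed

end

section \<open>The Euler--Ziegler restriction\<close>

text \<open>Division-free Cramer's rule: by column expansion the determinants with a replaced column
  are the entries of the adjugate applied to u.\<close>

lemma cramer_sum:
  fixes N :: "'a::comm_ring_1 mat"
  assumes N: "N \<in> carrier_mat n n" and i: "i < n"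
  shows "(\<Sum>j<n. N $$ (i, j) * det (mat n n (\<lambda>(s, t). if t = j then u s else N $$ (s, t)))) = det N * u i"
proof -
  have "det (mat n n (\<lambda>(s, t). if t = j then u s else N $$ (s, t))) = (\<Sum>l<n. u l * cofactor N l j)"
    if j: "j < n" for j
  proof -
    let ?M = "mat n n (\<lambda>(s, t). if t = j then u s else N $$ (s, t))"
    have del: "mat_delete ?M l j = mat_delete N l j" for l
      using N by (intro eq_matI) (auto simp: mat_delete_def)
    have "det ?M = (\<Sum>l<n. ?M $$ (l, j) * cofactor ?M l j)"
      by (rule laplace_expansion_column) (use j in auto)
    then show ?thesis using j by (simp add: cofactor_def del)
  qed
  then have "(\<Sum>j<n. N $$ (i, j) * det (mat n n (\<lambda>(s, t). if t = j then u s else N $$ (s, t)))) =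
      (\<Sum>j<n. N $$ (i, j) * (\<Sum>l<n. u l * cofactor N l j))"
    by simp
  also have "\<dots> = (\<Sum>l<n. u l * (\<Sum>j<n. N $$ (i, j) * cofactor N l j))"
    by (simp add: sum_distrib_left mult_ac) (rule sum.swap)
  also have "\<dots> = (\<Sum>l<n. u l * (if i = l then det N else 0))"
  proof (intro sum.cong refl)
    fix l assume "l \<in> {..<n}"
    then have 1: "(N * adj_mat N) $$ (i, l) = (\<Sum>j<n. N $$ (i, j) * cofactor N l j)"
      using N i by (simp add: scalar_prod_def adj_mat_def atLeast0LessThan)
    have 2: "(N * adj_mat N) $$ (i, l) = (if i = l then det N else 0)"
      using adj_mat(2)[OF N] i \<open>l \<in> {..<n}\<close> by auto
    show "u l * (\<Sum>j<n. N $$ (i, j) * cofactor N l j) = u l * (if i = l then det N else 0)"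
      by (simp only: 1[symmetric] 2)
  qed
  also have "\<dots> = det N * u i"
    using i by (simp add: if_distrib mult.commute cong: if_cong)
  finally show ?thesis .
qed

lemma in_I_singleton: "in_I {a} f \<longleftrightarrow> lin_poly a dvd f"
  unfolding in_I_def dvd_def by (auto simp: mult.commute intro: exI[of _ "\<lambda>_. _"])

lemma lf_shift:
  "lf c (\<lambda>i. v i - (if i = k then t else 0)) = lf c v - c k * t"
proof -
  have "(\<Sum>i\<in>UNIV. c i * (if i = k then t else 0)) = c k * t"
    by (simp add: if_distrib cong: if_cong)
  then show ?thesis by (simp add: lf_def right_diff_distrib sum_subtractf)
qed

context pointed_multiarrangement
begin

abbreviation \<sigma> :: "('n, 'k) spoly \<Rightarrow> ('n, 'k) spoly" where "\<sigma> \<equiv> sred (\<alpha> H0) k"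

text \<open>\<open>dform\<close> picks an arbitrary form cutting X out of \<open>H0\<close>,
  determined up to a scalar and up to multiples of \<open>\<alpha> H0\<close>. Applying
  \<open>restr_form\<close> removes the second ambiguity.\<close>

abbreviation \<beta> :: "('n \<Rightarrow> 'k) set \<Rightarrow> 'n \<Rightarrow> 'k" where "\<beta> X \<equiv> dform {\<alpha> H0} X"

sublocale \<sigma>: comm_ring_hom \<sigma>
  by (rule sred_hom)

lemma \<sigma>_eq_0_iff: "\<sigma> f = 0 \<longleftrightarrow> p H0 dvd f"
  by (rule sred_eq_0_iff) (rule k)

lemma \<sigma>_idem [simp]: "\<sigma> (\<sigma> f) = \<sigma> f"
  by (rule sred_idem) (rule k)

lemma congI_iff: "congI {\<alpha> H0} f g \<longleftrightarrow> \<sigma> f = \<sigma> g"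
  unfolding congI_def in_I_singleton \<sigma>_eq_0_iff[symmetric] by (simp add: \<sigma>.hom_minus)

lemma dvdI_iff: "dvdI {\<alpha> H0} f g \<longleftrightarrow> \<sigma> f dvd \<sigma> g"
proof
  assume "\<sigma> f dvd \<sigma> g"
  then obtain h where "\<sigma> g = \<sigma> f * h" by auto
  then have "\<sigma> (\<sigma> g) = \<sigma> (\<sigma> f * h)" by simp
  then show "dvdI {\<alpha> H0} f g" unfolding dvdI_def congI_iff by (auto simp: \<sigma>.hom_mult)
qed (auto simp: dvdI_def congI_iff \<sigma>.hom_mult)

lemma Wsp_H0: "Wsp {\<alpha> H0} = H0"
  using \<alpha>_kernel(1)[OF H0] by (simp add: Wsp_def)

lemma lf_H0: "v \<in> H0 \<Longrightarrow> lf (restr_form c) v = lf c v"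
  using \<alpha>_kernel(1)[OF H0] by (simp add: lf_lred) blast

lemma \<beta>_kernel:
  assumes "X \<in> restr A H0"
  shows "X = {v \<in> H0. lf (\<beta> X) v = 0}" "X \<noteq> H0"
proof -
  obtain H where H: "H \<in> A" "H \<noteq> H0" "X = H0 \<inter> H" using assms by (auto simp: restr_def)
  have "X = {v \<in> Wsp {\<alpha> H0}. lf (\<alpha> H) v = 0}"
    unfolding Wsp_H0 H(3) using \<alpha>_kernel(1)[OF H(1)] by blast
  moreover have "X \<noteq> Wsp {\<alpha> H0}"
    unfolding Wsp_H0 using hyperplane_subset_eq[OF H0 H(1)] H by auto
  ultimately have "\<exists>a. X = {v \<in> Wsp {\<alpha> H0}. lf a v = 0} \<and> X \<noteq> Wsp {\<alpha> H0}" by blast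
  from someI_ex[OF this] have h: "X = {v \<in> Wsp {\<alpha> H0}. lf (\<beta> X) v = 0}" "X \<noteq> Wsp {\<alpha> H0}"
    unfolding dform_def[of "{\<alpha> H0}"] by (rule conjunct1, rule conjunct2)
  show "X = {v \<in> H0. lf (\<beta> X) v = 0}" using h(1) unfolding Wsp_H0 .
  show "X \<noteq> H0" using h(2) unfolding Wsp_H0 .
qed

lemma \<beta>_restr_nonzero:
  assumes "X \<in> restr A H0"
  shows "restr_form (\<beta> X) \<noteq> (\<lambda>_. 0)"
proof
  assume "restr_form (\<beta> X) = (\<lambda>_. 0)"
  then have "lf (restr_form (\<beta> X)) v = 0" for v by (simp add: lf_def)
  then have "lf (\<beta> X) v = 0" if "v \<in> H0" for v
    using lf_H0[OF that, of "\<beta> X"] by simp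
  then have "{v \<in> H0. lf (\<beta> X) v = 0} = H0" by blast
  then show False using \<beta>_kernel[OF assms] by metis
qed

lemma restr_form_proportional:
  assumes X: "X \<in> restr A H0" and H: "H \<in> A" "H \<noteq> H0" "X \<subseteq> H"
  obtains c where "c \<noteq> 0" "restr_form (\<alpha> H) = (\<lambda>i. c * restr_form (\<beta> X) i)"
proof -
  let ?b = "restr_form (\<beta> X)" and ?a = "restr_form (\<alpha> H)"
  have bk: "?b k = 0" "?a k = 0" using k by simp_all
  obtain l where l: "?b l \<noteq> 0" using \<beta>_restr_nonzero[OF X] by auto
  have eq: "?a = (\<lambda>i. ?a l / ?b l * ?b i)"
  proof (rule lf_kernel_subset)
    show "?b l \<noteq> 0" by (rule l)
    fix v assume v: "lf ?b v = 0"
    \<comment> \<open>\<open>v\<close> is moved along the coordinate \<open>k\<close> into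
      \<open>H0\<close>; the reduced forms have coefficient 0 at \<open>k\<close>, so their values
      do not change.\<close>
    define w where "w = (\<lambda>i. v i - (if i = k then lf (\<alpha> H0) v / \<alpha> H0 k else 0))"
    have "lf (\<alpha> H0) w = 0" using k by (simp add: w_def lf_shift)
    then have wH0: "w \<in> H0" using \<alpha>_kernel(1)[OF H0] by blast
    have "lf ?b w = 0" using v by (simp add: w_def lf_shift bk)
    then have "lf (\<beta> X) w = 0" using lf_H0[OF wH0] by simp
    then have "w \<in> H" using wH0 \<beta>_kernel(1)[OF X] H(3) by blast
    then have "lf (\<alpha> H) w = 0" using \<alpha>_kernel(1)[OF H(1)] by blast
    then have "lf ?a w = 0" using lf_H0[OF wH0] by simp
    then show "lf ?a v = 0" by (simp add: w_def lf_shift bk)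
  qed
  moreover have "?a l / ?b l \<noteq> 0"
  proof
    assume "?a l / ?b l = 0"
    then have "?a = (\<lambda>_. 0)" using eq by (metis mult_zero_left)
    then show False using restr_form_nonzero[OF H(1,2)] by blast
  qed
  ultimately show ?thesis using that by blast
qed

text \<open>Proportional forms have the same zeros on \<open>H0\<close>. Hence the hyperplanes
  summed over in \<open>mrestr\<close> form the fibre over X of the map sending H to
  \<open>H0 \<inter> H\<close>.\<close>

lemma subset_iff_trace:
  assumes X: "X \<in> restr A H0" and H: "H \<in> A - {H0}"
  shows "X \<subseteq> H \<longleftrightarrow> H0 \<inter> H = X"
proof
  assume "X \<subseteq> H"
  then obtain c where c: "c \<noteq> 0" "restr_form (\<alpha> H) = (\<lambda>i. c * restr_form (\<beta> X) i)"
    using restr_form_proportional[OF X] H by blast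
  have "lf (\<alpha> H) v = c * lf (\<beta> X) v" if v: "v \<in> H0" for v
    using lf_scale[of c "restr_form (\<beta> X)" v] by (simp add: lf_H0[OF v] flip: c(2))
  then have "{v \<in> H0. lf (\<alpha> H) v = 0} = {v \<in> H0. lf (\<beta> X) v = 0}" using c(1) by auto
  moreover have "H0 \<inter> H = {v \<in> H0. lf (\<alpha> H) v = 0}"
    using \<alpha>_kernel(1)[of H] H by blast
  ultimately show "H0 \<inter> H = X" using \<beta>_kernel(1)[OF X] by simp
qed auto

lemma mrestr_eq:
  "X \<in> restr A H0 \<Longrightarrow> mrestr A m H0 X = (\<Sum>H\<in>{H \<in> A - {H0}. H0 \<inter> H = X}. m H)"
  unfolding mrestr_def using subset_iff_trace by (intro sum.cong) auto

lemma lin_poly_scale: "lin_poly (\<lambda>i. c * a i) = const_poly c * lin_poly a"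
  using lin_poly_lincomb[of c a 0 a] by simp

text \<open>Modulo \<open>\<alpha> H0\<close> every \<open>p H\<close> in the fibre over X becomes a
  unit times one and the same form, so the exponents add up to the multiplicity of X.\<close>

lemma \<sigma>_power_dvd_iff:
  assumes X: "X \<in> restr A H0"
  shows "(\<Prod>H\<in>{H \<in> A - {H0}. H0 \<inter> H = X}. \<sigma> (p H) ^ m H) dvd f \<longleftrightarrow>
    lin_poly (restr_form (\<beta> X)) ^ mrestr A m H0 X dvd f"
proof -
  let ?S = "{H \<in> A - {H0}. H0 \<inter> H = X}" and ?q = "lin_poly (restr_form (\<beta> X))"
  have q: "?q ^ mrestr A m H0 X = (\<Prod>H\<in>?S. ?q ^ m H)"
    by (simp add: mrestr_eq[OF X] power_sum)
  have "\<sigma> (p H) dvd ?q \<and> ?q dvd \<sigma> (p H)" if "H \<in> ?S" for H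
  proof -
    have "X \<subseteq> H" "H \<in> A" "H \<noteq> H0" using that by auto
    then obtain c where c: "c \<noteq> 0" "restr_form (\<alpha> H) = (\<lambda>i. c * restr_form (\<beta> X) i)"
      using restr_form_proportional[OF X] by blast
    have s: "\<sigma> (p H) = const_poly c * ?q"
      by (simp add: sred_lin_poly c(2) lin_poly_scale)
    have "\<sigma> (p H) dvd const_poly (inverse c) * \<sigma> (p H)" by simp
    also have "\<dots> = ?q" unfolding s by (simp add: const_poly_inverse[OF c(1)] flip: mult.assoc)
    finally show ?thesis using s by simp
  qed
  then have "(\<Prod>H\<in>?S. \<sigma> (p H) ^ m H) dvd ?q ^ mrestr A m H0 X"
    "?q ^ mrestr A m H0 X dvd (\<Prod>H\<in>?S. \<sigma> (p H) ^ m H)"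
    unfolding q by (auto intro!: prod_dvd_prod dvd_power_same)
  then show ?thesis using dvd_trans by blast
qed

text \<open>Grouping factors by their trace on \<open>H0\<close> shows that
  \<open>\<sigma> (Q_omit H0)\<close> divides the defining polynomial of the restriction. The forms
  of distinct X are non-associated primes, so their powers may be combined.\<close>

lemma \<sigma>_Q_omit_dvd:
  assumes "\<And>X. X \<in> restr A H0 \<Longrightarrow> lin_poly (restr_form (\<beta> X)) ^ mrestr A m H0 X dvd f"
  shows "\<sigma> (Q_omit H0) dvd f"
proof -
  let ?q = "\<lambda>X. \<Prod>H\<in>{H \<in> A - {H0}. H0 \<inter> H = X}. \<sigma> (p H) ^ m H"
  have "\<sigma> (Q_omit H0) = (\<Prod>H\<in>A - {H0}. \<sigma> (p H) ^ m H)"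
    by (simp add: Q_omit_def \<sigma>.hom_prod \<sigma>.hom_power)
  also have "\<dots> = (\<Prod>X\<in>restr A H0. ?q X)"
    unfolding restr_def by (rule prod.image_gen) (simp add: finite_A)
  also have "\<dots> dvd (\<Prod>X\<in>restr A H0. lin_poly (restr_form (\<beta> X)) ^ mrestr A m H0 X)"
    by (rule prod_dvd_prod) (rule iffD2[OF \<sigma>_power_dvd_iff dvd_refl])
  also have "\<dots> dvd f"
  proof (rule prod_prime_powers_dvd)
    show "finite (restr A H0)" by (simp add: restr_def finite_A)
    show "prime_elem (lin_poly (restr_form (\<beta> X)))" if "X \<in> restr A H0" for X
      by (rule prime_elem_lin_poly[OF \<beta>_restr_nonzero[OF that]])
    show "\<not> lin_poly (restr_form (\<beta> X)) dvd lin_poly (restr_form (\<beta> Y))"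
      if XY: "X \<in> restr A H0" "Y \<in> restr A H0" "X \<noteq> Y" for X Y
    proof
      assume dvd: "lin_poly (restr_form (\<beta> X)) dvd lin_poly (restr_form (\<beta> Y))"
      have "lf (\<beta> Y) v = 0" if "v \<in> H0" "lf (\<beta> X) v = 0" for v
        using lin_poly_dvd_kernel[OF dvd, of v] that by (simp add: lf_H0)
      then have "X \<subseteq> Y" using \<beta>_kernel(1)[OF XY(1)] \<beta>_kernel(1)[OF XY(2)] by blast
      moreover obtain H where "H \<in> A - {H0}" "Y = H0 \<inter> H" using XY(2) by (auto simp: restr_def)
      ultimately show False using subset_iff_trace[OF XY(1)] XY(3) by blast
    qed
  qed (rule assms)
  finally show ?thesis .
qed

lemma Dmod_restr_iff:
  "\<theta> \<in> Dmod {\<alpha> H0} (restr A H0) (mrestr A m H0) \<longleftrightarrow> \<sigma> (dapp \<theta> (\<alpha> H0)) = 0 \<and>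
    (\<forall>X\<in>restr A H0. lin_poly (restr_form (\<beta> X)) ^ mrestr A m H0 X dvd \<sigma> (dapp \<theta> (\<beta> X)))"
  by (simp add: Dmod_def in_I_singleton \<sigma>_eq_0_iff dvdI_iff \<sigma>.hom_power sred_lin_poly)

text \<open>The value on \<open>\<beta> X\<close> is a nonzero scalar times the value on each
  \<open>\<alpha> H\<close> in the fibre over X, as \<theta> kills \<open>\<alpha> H0\<close>. In S
  the \<open>p H\<close> are still distinct primes, so the product of their powers divides it;
  reduction by \<sigma> comes only afterwards.\<close>

lemma restrict_derivation:
  assumes \<theta>: "\<theta> \<in> Dmod {} A m" "dapp \<theta> (\<alpha> H0) = 0"
  shows "\<theta> \<in> Dmod {\<alpha> H0} (restr A H0) (mrestr A m H0)"
  unfolding Dmod_restr_iff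
proof (intro conjI ballI)
  fix X assume X: "X \<in> restr A H0"
  let ?S = "{H \<in> A - {H0}. H0 \<inter> H = X}"
  have "(\<Prod>H\<in>?S. p H ^ m H) dvd dapp \<theta> (\<beta> X)"
  proof (rule prod_prime_powers_dvd)
    fix H assume "H \<in> ?S"
    then have H: "H \<in> A" "H \<noteq> H0" "X \<subseteq> H" by auto
    obtain c where c: "c \<noteq> 0" "restr_form (\<alpha> H) = (\<lambda>i. c * restr_form (\<beta> X) i)"
      using restr_form_proportional[OF X H] .
    have "dapp \<theta> (\<alpha> H) = dapp \<theta> (restr_form (\<alpha> H))" by (simp add: dapp_lred \<theta>(2))
    also have "\<dots> = const_poly c * dapp \<theta> (restr_form (\<beta> X))"
      unfolding c(2) using dapp_lincomb[of \<theta> c "restr_form (\<beta> X)" 0 "restr_form (\<beta> X)"] by simp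
    also have "\<dots> = const_poly c * dapp \<theta> (\<beta> X)" by (simp add: dapp_lred \<theta>(2))
    finally have "dapp \<theta> (\<alpha> H) = const_poly c * dapp \<theta> (\<beta> X)" .
    moreover have "p H ^ m H dvd dapp \<theta> (\<alpha> H)" using \<theta>(1) H(1) by (simp add: Dmod_empty_iff)
    ultimately show "p H ^ m H dvd dapp \<theta> (\<beta> X)" by (simp add: dvd_const_mult_iff[OF c(1)])
  qed (use finite_A prime_p p_not_dvd in auto)
  then have "\<sigma> (\<Prod>H\<in>?S. p H ^ m H) dvd \<sigma> (dapp \<theta> (\<beta> X))" by (rule \<sigma>.hom_dvd)
  then have "(\<Prod>H\<in>?S. \<sigma> (p H) ^ m H) dvd \<sigma> (dapp \<theta> (\<beta> X))"
    by (simp add: \<sigma>.hom_prod \<sigma>.hom_power)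
  then show "lin_poly (restr_form (\<beta> X)) ^ mrestr A m H0 X dvd \<sigma> (dapp \<theta> (\<beta> X))"
    by (rule iffD1[OF \<sigma>_power_dvd_iff[OF X]])
qed (simp add: \<theta>(2))

lemma \<sigma>_const [simp]: "\<sigma> (const_poly c) = const_poly c"
  by (simp add: sred_def)

lemma \<sigma>_dapp: "\<sigma> (dapp \<theta> c) = dapp (\<lambda>i. \<sigma> (\<theta> i)) c"
  by (simp add: dapp_def \<sigma>.hom_sum \<sigma>.hom_mult)

lemma \<sigma>_dapp_restr:
  assumes "\<sigma> (dapp \<theta> (\<alpha> H0)) = 0"
  shows "\<sigma> (dapp \<theta> c) = (\<Sum>i<n. const_poly (restr_form c (e (Suc i))) * \<sigma> (\<theta> (e (Suc i))))"
proof -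
  have "\<sigma> (dapp \<theta> (restr_form c)) = \<sigma> (dapp \<theta> c)"
    using assms by (simp add: dapp_lred \<sigma>.hom_minus \<sigma>.hom_mult)
  then have "\<sigma> (dapp \<theta> c) = dapp (\<lambda>i. \<sigma> (\<theta> i)) (restr_form c)" by (simp only: \<sigma>_dapp)
  also have "\<dots> = (\<Sum>i<n. const_poly (restr_form c (e (Suc i))) * \<sigma> (\<theta> (e (Suc i))))"
    by (rule dapp_no_k) (use k in simp)
  finally show ?thesis .
qed

text \<open>The relation \<theta>(\<alpha>_0) = 0 modulo \<alpha>_0 can be solved for the coordinate
  \<open>k\<close>, whose coefficient is nonzero, so the other coordinates determine the
  derivation.\<close>

lemma congI_of_coords:
  assumes "\<sigma> (dapp \<theta> (\<alpha> H0)) = 0" "\<sigma> (dapp \<eta> (\<alpha> H0)) = 0"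
    and eq: "\<And>i. i < n \<Longrightarrow> \<sigma> (\<theta> (e (Suc i))) = \<sigma> (\<eta> (e (Suc i)))"
  shows "congI {\<alpha> H0} (\<theta> l) (\<eta> l)"
proof -
  have "const_poly (\<alpha> H0 k) * \<sigma> (\<zeta> k) = - (\<Sum>i<n. const_poly (\<alpha> H0 (e (Suc i))) * \<sigma> (\<zeta> (e (Suc i))))"
    if "\<sigma> (dapp \<zeta> (\<alpha> H0)) = 0" for \<zeta>
    using that unfolding \<sigma>_dapp unfolding dapp_coord[OF e] sum.lessThan_Suc_shift e0 by (simp only: eq_neg_iff_add_eq_0)
  then have "const_poly (\<alpha> H0 k) * \<sigma> (\<theta> k) = const_poly (\<alpha> H0 k) * \<sigma> (\<eta> k)"
    using assms(1,2) eq by simp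
  moreover have "const_poly (\<alpha> H0 k) \<noteq> (0 :: ('n, 'k) spoly)"
    using const_poly_dvd_1[OF k] by (metis dvd_0_left_iff zero_neq_one)
  ultimately have k_eq: "\<sigma> (\<theta> k) = \<sigma> (\<eta> k)" using spoly_mult_cancel by blast
  obtain i where i: "i < Suc n" "e i = l"
    using e by (metis UNIV_I bij_betw_iff_bijections lessThan_iff)
  show ?thesis
    unfolding congI_iff using eq[of "i - 1"] i k_eq e0 by (cases i) auto
qed

end

locale good_basis = pointed_multiarrangement +
  fixes b :: "nat \<Rightarrow> 'a \<Rightarrow> ('a, 'b) spoly"
  assumes basis: "poly_basis (Dmod {} A m) (Suc n) b"
    and b0: "dapp (b 0) (\<alpha> H0) = p H0 ^ m H0"
    and b_pos: "\<And>j. j < n \<Longrightarrow> dapp (b (Suc j)) (\<alpha> H0) = 0"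
begin

definition N where "N = mat n n (\<lambda>(i, j). \<sigma> (b (Suc j) (e (Suc i))))"

lemma N_carrier: "N \<in> carrier_mat n n"
  by (simp add: N_def)

lemma b_D: "j < n \<Longrightarrow> b (Suc j) \<in> Dmod {} A m"
  using basis by (simp add: poly_basis_def)

lemma det_N_dvd: "det N dvd \<sigma> (Q_omit H0)"
proof -
  \<comment> \<open>For a good summand the cofactor \<open>f\<close> of
    \<open>minor_dvd_Q_omit\<close> is 1.\<close>
  have "1 * det (mat n n (\<lambda>(i, j). b (Suc j) (e (Suc i)))) dvd Q_omit H0"
    by (rule minor_dvd_Q_omit[OF basis]) (use b0 b_pos in \<open>auto simp: less_Suc_eq_0_disj\<close>)
  then have "\<sigma> (det (mat n n (\<lambda>(i, j). b (Suc j) (e (Suc i))))) dvd \<sigma> (Q_omit H0)"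
    using \<sigma>.hom_dvd by simp
  moreover have "N = map_mat \<sigma> (mat n n (\<lambda>(i, j). b (Suc j) (e (Suc i))))"
    unfolding N_def by (rule eq_matI) auto
  ultimately show ?thesis by (simp add: \<sigma>.hom_det)
qed

lemma \<sigma>_Q_omit_nonzero: "\<sigma> (Q_omit H0) \<noteq> 0"
  using p_not_dvd_Q_omit[OF H0] by (simp add: \<sigma>_eq_0_iff)

lemma det_N_nonzero: "det N \<noteq> 0"
  using det_N_dvd \<sigma>_Q_omit_nonzero by auto

text \<open>Replacing a column of \<open>N\<close> by \<theta> keeps all columns in the module of
  the restriction, so the determinant stays divisible by \<open>\<sigma> (Q_omit H0)\<close> and
  hence by \<open>det N\<close>. The quotients in Cramer's rule are therefore polynomials.\<close>

lemma restriction_spanned: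
  assumes \<theta>: "\<theta> \<in> Dmod {\<alpha> H0} (restr A H0) (mrestr A m H0)"
  shows "\<exists>r. \<forall>i. congI {\<alpha> H0} (\<theta> i) (\<Sum>j<n. r j * b (Suc j) i)"
proof -
  let ?u = "\<lambda>i. \<sigma> (\<theta> (e (Suc i)))"
  let ?M = "\<lambda>j. mat n n (\<lambda>(s, t). if t = j then ?u s else N $$ (s, t))"
  obtain h where h: "\<sigma> (Q_omit H0) = det N * h" using det_N_dvd by auto
  have "\<sigma> (Q_omit H0) dvd det (?M j)" if j: "j < n" for j
  proof (rule \<sigma>_Q_omit_dvd)
    fix X assume X: "X \<in> restr A H0"
    let ?c = "restr_form (\<beta> X)"
    have ck: "?c k = 0" using k by simp
    obtain l where l: "l < n" "?c (e (Suc l)) \<noteq> 0"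
      using coord_nonzero[OF ck \<beta>_restr_nonzero[OF X]] by blast
    have "lin_poly ?c ^ mrestr A m H0 X dvd const_poly (?c (e (Suc l))) * det (?M j)"
    proof (rule dvd_mult_det[where n = n and c = "\<lambda>i. const_poly (?c (e (Suc i)))"])
      fix t assume t: "t < n"
      define \<eta> where "\<eta> = (if t = j then \<theta> else b (Suc t))"
      have \<eta>: "\<eta> \<in> Dmod {\<alpha> H0} (restr A H0) (mrestr A m H0)"
        using \<theta> restrict_derivation[OF b_D[OF t] b_pos[OF t]] by (simp add: \<eta>_def)
      have "(\<Sum>i<n. const_poly (?c (e (Suc i))) * ?M j $$ (i, t)) = \<sigma> (dapp \<eta> (\<beta> X))"
        using \<eta> t by (subst \<sigma>_dapp_restr) (auto simp: Dmod_restr_iff \<eta>_def N_def)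
      then show "lin_poly ?c ^ mrestr A m H0 X dvd (\<Sum>i<n. const_poly (?c (e (Suc i))) * ?M j $$ (i, t))"
        using \<eta> X by (simp add: Dmod_restr_iff)
    qed (use l in auto)
    then show "lin_poly ?c ^ mrestr A m H0 X dvd det (?M j)"
      using dvd_const_mult_iff[OF l(2)] by blast
  qed
  then have "\<forall>j. \<exists>w. j < n \<longrightarrow> det (?M j) = \<sigma> (Q_omit H0) * w"
    unfolding dvd_def by blast
  from choice[OF this] obtain w where w: "\<And>j. j < n \<Longrightarrow> det (?M j) = \<sigma> (Q_omit H0) * w j" by blast
  \<comment> \<open>The Cramer quotient: the determinant of \<open>?M j\<close> equals
    \<open>det N * h * w j\<close>.\<close>
  define r where "r j = h * w j" for j
  have u: "?u i = (\<Sum>j<n. r j * \<sigma> (b (Suc j) (e (Suc i))))" if i: "i < n" for i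
  proof -
    have "det N * ?u i = (\<Sum>j<n. N $$ (i, j) * det (?M j))"
      by (rule cramer_sum[OF N_carrier i, symmetric])
    also have "\<dots> = det N * (\<Sum>j<n. r j * \<sigma> (b (Suc j) (e (Suc i))))"
      using i by (simp add: w h r_def N_def sum_distrib_left mult_ac)
    finally show ?thesis by (rule spoly_mult_cancel[OF det_N_nonzero])
  qed
  have "congI {\<alpha> H0} (\<theta> l) (\<Sum>j<n. r j * b (Suc j) l)" for l
  proof (rule congI_of_coords)
    show "\<sigma> (dapp \<theta> (\<alpha> H0)) = 0" using \<theta> by (simp add: Dmod_restr_iff)
    show "\<sigma> (dapp (\<lambda>l. \<Sum>j<n. r j * b (Suc j) l) (\<alpha> H0)) = 0"
      by (simp add: dapp_sum b_pos)
    fix i assume i: "i < n"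
    \<comment> \<open>The coefficients \<open>r j\<close> may involve the variable k, so \<sigma> is
      applied once more to bring both sides into reduced form.\<close>
    have "\<sigma> (?u i) = \<sigma> (\<Sum>j<n. r j * \<sigma> (b (Suc j) (e (Suc i))))" by (simp only: u[OF i])
    then show "\<sigma> (\<theta> (e (Suc i))) = \<sigma> (\<Sum>j<n. r j * b (Suc j) (e (Suc i)))"
      by (simp add: \<sigma>.hom_sum \<sigma>.hom_mult)
  qed
  then show ?thesis by blast
qed

lemma restriction_independent:
  assumes r: "\<And>i. congI {\<alpha> H0} (\<Sum>j<n. r j * b (Suc j) i) 0" and j: "j < n"
  shows "congI {\<alpha> H0} (r j) 0"
proof -
  define \<theta> where "\<theta> i = (\<Sum>j<n. r j * b (Suc j) i)" for i
  have "\<exists>\<eta>. \<theta> i = p H0 * \<eta>" for i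
    using r[of i] by (auto simp: congI_iff \<theta>_def \<sigma>_eq_0_iff dvd_def)
  then obtain \<eta> where \<eta>: "\<And>i. \<theta> i = p H0 * \<eta> i" by metis
  have dapp_\<theta>: "dapp \<theta> c = (\<Sum>j<n. r j * dapp (b (Suc j)) c)" for c
    unfolding \<theta>_def[abs_def] by (rule dapp_sum)
  have dapp_\<eta>: "dapp \<theta> c = p H0 * dapp \<eta> c" for c
    using dapp_mult[of "p H0" \<eta> c] by (simp flip: \<eta>)
  \<comment> \<open>At \<open>H0\<close> the value of \<eta> is 0, because \<theta> kills
    \<open>\<alpha> H0\<close>; at the other H the prime power passes through the factor
    \<open>p H0\<close>.\<close>
  have "\<eta> \<in> Dmod {} A m"
    unfolding Dmod_empty_iff
  proof
    fix H assume H: "H \<in> A"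
    show "p H ^ m H dvd dapp \<eta> (\<alpha> H)"
    proof (cases "H = H0")
      case True
      have "p H0 * dapp \<eta> (\<alpha> H0) = p H0 * 0"
        by (simp add: b_pos dapp_\<theta> flip: dapp_\<eta>)
      then have "dapp \<eta> (\<alpha> H0) = 0"
        by (rule spoly_mult_cancel[rotated]) (use prime_p[OF H0] in auto)
      then show ?thesis using True by simp
    next
      case False
      have "p H ^ m H dvd p H0 * dapp \<eta> (\<alpha> H)"
        unfolding dapp_\<eta>[symmetric] dapp_\<theta>
        using b_D H by (intro dvd_sum dvd_mult) (auto simp: Dmod_empty_iff)
      then show ?thesis
        using prime_power_dvd_mult[OF prime_p[OF H] p_not_dvd[OF H H0 False]] by blast
    qed
  qed
  then obtain s where s: "\<And>i. \<eta> i = (\<Sum>j<Suc n. s j * b j i)"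
    using poly_basis_span[OF basis] by blast
  \<comment> \<open>Coefficients of \<theta> minus \<open>p H0\<close> times \<eta> in the full
    basis. The shift by one and the value 0 at j = 0 arise because \<theta> does not involve the
    good summand \<open>b 0\<close>.\<close>
  define t where "t j = (if j = 0 then 0 else r (j - 1)) - p H0 * s j" for j
  have "(\<Sum>j<Suc n. t j * b j i) = 0" for i
  proof -
    have "(\<Sum>j<Suc n. t j * b j i) = \<theta> i - p H0 * \<eta> i"
      unfolding s sum_distrib_left t_def left_diff_distrib sum_subtractf
      by (simp add: \<theta>_def sum.lessThan_Suc_shift mult.assoc del: sum.lessThan_Suc)
    then show ?thesis by (simp add: \<eta>)
  qed
  from poly_basis_indep[OF basis this, of "Suc j"] j have "r j = p H0 * s (Suc j)"
    by (simp add: t_def)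
  then show ?thesis by (simp add: congI_iff \<sigma>_eq_0_iff)
qed

lemma restriction_free:
  assumes hom: "\<And>j i. j < n \<Longrightarrow> hom_or_zero (b (Suc j) i) (d j)"
  shows "free_exp {\<alpha> H0} (restr A H0) (mrestr A m H0) (mset (map d [0..<n]))"
  unfolding free_exp_def
proof (intro exI[of _ "map (\<lambda>j. b (Suc j)) [0..<n]"] exI[of _ "map d [0..<n]"] conjI allI impI ballI)
  fix j assume "j < length (map (\<lambda>j. b (Suc j)) [0..<n])"
  then have j: "j < n" by simp
  show "map (\<lambda>j. b (Suc j)) [0..<n] ! j \<in> Dmod {\<alpha> H0} (restr A H0) (mrestr A m H0)"
    using restrict_derivation[OF b_D[OF j] b_pos[OF j]] j by simp
  show "has_pdeg {\<alpha> H0} (map (\<lambda>j. b (Suc j)) [0..<n] ! j) (map d [0..<n] ! j)"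
    unfolding has_pdeg_def using j hom by (intro exI[of _ "b (Suc j)"]) (simp add: congI_iff)
next
  fix \<theta> assume "\<theta> \<in> Dmod {\<alpha> H0} (restr A H0) (mrestr A m H0)"
  from restriction_spanned[OF this]
  show "\<exists>r. \<forall>i. congI {\<alpha> H0} (\<theta> i)
      (\<Sum>j<length (map (\<lambda>j. b (Suc j)) [0..<n]). r j * (map (\<lambda>j. b (Suc j)) [0..<n] ! j) i)"
    by simp
next
  fix r j
  assume r: "\<forall>i. congI {\<alpha> H0}
      (\<Sum>j<length (map (\<lambda>j. b (Suc j)) [0..<n]). r j * (map (\<lambda>j. b (Suc j)) [0..<n] ! j) i) 0"
    and "j < length (map (\<lambda>j. b (Suc j)) [0..<n])"
  then have j: "j < n" by simp
  have "congI {\<alpha> H0} (\<Sum>j<n. r j * b (Suc j) i) 0" for i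
    using r[rule_format, of i] by simp
  from restriction_independent[OF this j] show "congI {\<alpha> H0} (r j) 0" .
qed auto

end

theorem theorem3p4:
  fixes A :: "('n::finite \<Rightarrow> 'k::field) set set"
    and m :: "('n \<Rightarrow> 'k) set \<Rightarrow> nat"
    and H0 :: "('n \<Rightarrow> 'k) set"
    and E :: "nat multiset"
  assumes "multiarr {} A m"
    and "free_exp {} A m E"
    and "H0 \<in> A"
    and "heavy A m H0"
  shows "(\<exists>\<theta>0. good_summand A m H0 \<theta>0) \<and> m H0 \<in># E \<and>
         free_exp {dform {} H0} (restr A H0) (mrestr A m H0) (E - {#m H0#})"
proof -
  interpret multiarrangement A m by standard (rule assms(1))
  obtain B ds where len: "length B = length ds" and E: "mset ds = E"
    and B: "\<forall>j<length B. B ! j \<in> Dmod {} A m \<and> has_pdeg {} (B ! j) (ds ! j)"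
      "\<forall>\<theta>\<in>Dmod {} A m. \<exists>r. \<forall>i. congI {} (\<theta> i) (\<Sum>j<length B. r j * (B ! j) i)"
      "\<forall>r. (\<forall>i. congI {} (\<Sum>j<length B. r j * (B ! j) i) 0) \<longrightarrow> (\<forall>j<length B. congI {} (r j) 0)"
    using assms(2) unfolding free_exp_def by (elim exE conjE) (rule that, assumption+)
  have basis: "poly_basis (Dmod {} A m) (length B) (\<lambda>j. B ! j)"
    using B unfolding poly_basis_def congI_empty by blast
  have card: "length B = card (UNIV :: 'n set)" by (rule basis_card[OF basis])
  then have "length B \<noteq> 0" by simp
  then obtain n where n: "length B = Suc n" using not0_implies_Suc by blast
  obtain k where k: "\<alpha> H0 k \<noteq> 0" using \<alpha>_nonzero[OF assms(3)] by auto
  obtain e :: "nat \<Rightarrow> 'n" where e: "bij_betw e {..<Suc n} UNIV" "e 0 = k"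
    using coord_bij_starting_at[of k] card n by metis
  interpret pointed_multiarrangement A m H0 k e n
    by standard (use assms(3) k e in auto)
  have hom: "hom_or_zero ((B ! j) i) (ds ! j)" if "j < Suc n" for j i
    using B(1) that n by (simp add: has_pdeg_empty)
  obtain j0 b where j0: "j0 < Suc n" and b: "poly_basis (Dmod {} A m) (Suc n) b"
    "\<And>j i. j < Suc n \<Longrightarrow> hom_or_zero (b j i) (ds ! transpose 0 j0 j)" "ds ! j0 = m H0"
    "dapp (b 0) (\<alpha> H0) = p H0 ^ m H0"
    "\<And>j. 0 < j \<Longrightarrow> j < Suc n \<Longrightarrow> dapp (b j) (\<alpha> H0) = 0"
    using normalized_basis[OF basis[unfolded n] hom assms(4)] by metis
  interpret good_basis A m H0 k e n b
    by standard (use b in auto)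
  have "good_summand A m H0 (b 0)"
    unfolding good_summand_def has_pdeg_empty
    using b(1,4) b(2)[of 0] b(3) by (simp add: poly_basis_def)
  moreover have mem: "m H0 \<in># E" using j0 b(3) n len E by (metis in_multiset_in_set nth_mem)
  moreover have "free_exp {\<alpha> H0} (restr A H0) (mrestr A m H0) (mset (map (\<lambda>j. ds ! transpose 0 j0 (Suc j)) [0..<n]))"
    by (rule restriction_free) (use b(2) in auto)
  moreover have "mset (map (\<lambda>j. ds ! transpose 0 j0 (Suc j)) [0..<n]) = E - {#m H0#}"
  proof -
    \<comment> \<open>Exchanging positions 0 and j0 puts the exponent \<open>m H0\<close> first, so
      deleting one copy of it leaves the tail of the reordered list.\<close>
    let ?t = "transpose 0 j0"
    have t: "bij_betw ?t {0..<Suc n} {0..<Suc n}"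
      using j0 by (intro bij_betwI[where g = ?t]) (auto simp: transpose_def)
    have "E = mset (map ((!) ds) [0..<Suc n])" using E len n by (metis map_nth)
    also have "\<dots> = image_mset ((!) ds) (mset_set {0..<Suc n})" by (simp del: upt_Suc)
    also have "mset_set {0..<Suc n} = image_mset ?t (mset_set {0..<Suc n})"
      using t by (simp add: bij_betw_def image_mset_mset_set)
    also have "image_mset ((!) ds) \<dots> = mset (map (\<lambda>j. ds ! ?t j) [0..<Suc n])"
      by (simp add: multiset.map_comp comp_def del: upt_Suc)
    also have "[0..<Suc n] = 0 # map Suc [0..<n]" by (simp add: upt_conv_Cons map_Suc_upt del: upt_Suc)
    finally have "E = add_mset (m H0) (mset (map (\<lambda>j. ds ! ?t (Suc j)) [0..<n]))"
      by (simp add: b(3) comp_def del: upt_Suc)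
    then show ?thesis by simp
  qed
  ultimately show ?thesis by auto
qed

end
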